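(* Let $\mathcal{G}$ be a connected metric graph with vertex set $\mathsf{V}$ and let $\alpha\in[0,\infty)^{\mathsf{V}}$ be not identically zero. Let edges $\mathsf{e}_1,\dots,\mathsf{e}_r$ be pendant and incident to the same vertex $\mathsf{v}_0$, and denote by $\mathsf{v}_j$ the (other, degree one) end point of $\mathsf{e}_j$, $j=1,\dots,r$. Let $\tilde{\mathcal{G}}$ be the metric graph obtained from $\mathcal{G}$ by replacing $\mathsf{e}_1,\dots,\mathsf{e}_r$ by a single pendant edge $\hat{\mathsf{e}}$ at $\mathsf{v}_0$ of length $\ell_{\hat{\mathsf{e}}}=\sum_{j=1}^r\ell_{\mathsf{e}_j}$, and denote the vertex at the other end point of $\hat{\mathsf{e}}$ by $\hat{\mathsf{v}}$. Let $\tilde\alpha\in[0,\infty)^{(\mathsf{V}\cup\{\hat{\mathsf{v}}\})\setminus\{\mathsf{v}_1,\dots,\mathsf{v}_r\}}$ be defined by $\tilde\alpha_{\mathsf{v}}=\alpha_{\mathsf{v}}$ if $\mathsf{v}\in\mathsf{V}\setminus\{\mathsf{v}_1,\dots,\mathsf{v}_r\}$ and $\tilde\alpha_{\hat{\mathsf{v}}}=0$, and assume that $\tilde\alpha$ is not identically zero. Then $T(\mathcal{G},\alpha)\leq T(\tilde{\mathcal{G}},\tilde\alpha)$.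
   Context: A metric graph $\mathcal{G}$ is a finite collection of intervals glued together at their endpoints according to a finite combinatorial graph $(\mathsf{V},\mathsf{E})$ (loops and multiple edges allowed); each edge $\mathsf{e}\in\mathsf{E}$ is identified with $[0,\ell_{\mathsf{e}}]$, $\ell_{\mathsf{e}}\in(0,\infty)$. It is connected if any two points are joined by a continuous path. $\mathsf{E}_{\mathsf{v}}$ is the collection of edges incident to $\mathsf{v}$ (a loop at $\mathsf{v}$ counted twice, once for each endpoint), $u_{\mathsf{e}}$ is the restriction of $u$ to $\mathsf{e}$, and $\frac{\partial u_{\mathsf{e}}}{\partial n}(\mathsf{v})$ is the derivative of $u_{\mathsf{e}}$ at the endpoint $\mathsf{v}$ in the direction pointing into $\mathsf{v}$. The degree of $\mathsf{v}$ is $|\mathsf{E}_{\mathsf{v}}|$; an edge is pendant if one of its vertices has degree one. For $\alpha\in\mathbb{R}^{\mathsf{V}}$ (the strengths), the operator $-\Delta_{\mathcal{G},\alpha}$ in $L^2(\mathcal{G})$ acts as $u\mapsto -u''$ on each edge, on functions that are edgewise in $H^2(0,\ell_{\mathsf{e}})$, continuous at every vertex, and satisfy $\sum_{\mathsf{e}\in\mathsf{E}_{\mathsf{v}}}\frac{\partial u_{\mathsf{e}}}{\partial n}(\mathsf{v})+\alpha_{\mathsf{v}}u(\mathsf{v})=0$ for all $\mathsf{v}\in\mathsf{V}$. The torsion function of $(\mathcal{G},\alpha)$ is the unique solution $\upsilon$ of $-\Delta_{\mathcal{G},\alpha}\upsilon=1$ (it exists and is strictly positive when $\mathcal{G}$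 is connected and $\alpha\in[0,\infty)^{\mathsf{V}}$ is not identically zero), and the torsional rigidity is $T(\mathcal{G},\alpha)=\int_{\mathcal{G}}\upsilon(x)\,\mathrm{d}x$. *)

theory Defs
  imports "HOL-Analysis.Analysis"
begin

section \<open>Metric graphs\<close>

text \<open>
  The edge \<open>e\<close> is the interval \<open>[0, len G e]\<close>; its coordinate 0 is glued to \<open>source G e\<close> and its
  coordinate \<open>len G e\<close> to \<open>target G e\<close>. This orientation only serves to parametrise the edge. Loops
  and multiple edges are allowed.
\<close>

record ('v, 'e) metric_graph =
  verts :: "'v set"
  edges :: "'e set"
  source :: "'e \<Rightarrow> 'v"
  target :: "'e \<Rightarrow> 'v"
  len :: "'e \<Rightarrow> real"

definition metric_graph :: "('v, 'e) metric_graph \<Rightarrow> bool" where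
  "metric_graph G \<longleftrightarrow>
     finite (verts G) \<and> finite (edges G) \<and>
     (\<forall>e\<in>edges G. source G e \<in> verts G \<and> target G e \<in> verts G \<and> 0 < len G e)"

definition endpoints :: "('v, 'e) metric_graph \<Rightarrow> 'e \<Rightarrow> 'v set" where
  "endpoints G e = {source G e, target G e}"

text \<open>
  The edges incident to \<open>v\<close>, each paired with the coordinate of the edge end that lies at \<open>v\<close>. A loop
  at \<open>v\<close> contributes two elements because \<open>0 < len G e\<close>.
\<close>

definition incident_ends :: "('v, 'e) metric_graph \<Rightarrow> 'v \<Rightarrow> ('e \<times> real) set" where
  "incident_ends G v =
     {(e, x). e \<in> edges G \<and> (x = 0 \<and> source G e = v \<or> x = len G e \<and> target G e = v)}"

definition vertex_degree :: "('v, 'e) metric_graph \<Rightarrow> 'v \<Rightarrow> nat" where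
  "vertex_degree G v = card (incident_ends G v)"

definition pendant :: "('v, 'e) metric_graph \<Rightarrow> 'e \<Rightarrow> bool" where
  "pendant G e \<longleftrightarrow> e \<in> edges G \<and> (\<exists>v\<in>endpoints G e. vertex_degree G v = 1)"


section \<open>The underlying topological space\<close>

datatype ('v, 'e) point = Vertex 'v | Interior 'e real

definition points :: "('v, 'e) metric_graph \<Rightarrow> ('v, 'e) point set" where
  "points G = Vertex ` verts G \<union> {Interior e x | e x. e \<in> edges G \<and> 0 < x \<and> x < len G e}"

text \<open>The gluing map, used for \<open>0 \<le> x \<le> len G e\<close>.\<close>

definition edge_point :: "('v, 'e) metric_graph \<Rightarrow> 'e \<Rightarrow> real \<Rightarrow> ('v, 'e) point" where
  "edge_point G e x =
     (if x = 0 then Vertex (source G e)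
      else if x = len G e then Vertex (target G e)
      else Interior e x)"

text \<open>
  The quotient topology of the glued intervals (the finest topology making all gluing maps
  continuous).
\<close>

definition graph_topology :: "('v, 'e) metric_graph \<Rightarrow> ('v, 'e) point topology" where
  "graph_topology G =
     topology (\<lambda>U. U \<subseteq> points G \<and>
       (\<forall>e\<in>edges G. openin (top_of_set {0..len G e}) {x \<in> {0..len G e}. edge_point G e x \<in> U}))"

lemma openin_graph_topology:
  "openin (graph_topology G) U \<longleftrightarrow>
     U \<subseteq> points G \<and>
     (\<forall>e\<in>edges G. openin (top_of_set {0..len G e}) {x \<in> {0..len G e}. edge_point G e x \<in> U})"
proof -
  have "istopology (\<lambda>U. U \<subseteq> points G \<and>
     (\<forall>e\<in>edges G. openin (top_of_set {0..len G e}) {x \<in> {0..len G e}. edge_point G e x \<in> U}))"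
    (is "istopology ?P")
    unfolding istopology_def
  proof (intro conjI allI impI)
    fix S T assume S: "?P S" and T: "?P T"
    have "{x \<in> {0..len G e}. edge_point G e x \<in> S \<inter> T} =
      {x \<in> {0..len G e}. edge_point G e x \<in> S} \<inter> {x \<in> {0..len G e}. edge_point G e x \<in> T}" for e
      by auto
    then show "S \<inter> T \<subseteq> points G"
      and "\<forall>e\<in>edges G. openin (top_of_set {0..len G e}) {x \<in> {0..len G e}. edge_point G e x \<in> S \<inter> T}"
      using S T by (auto simp only: intro: openin_Int)
  next
    fix \<K> assume K: "\<forall>S\<in>\<K>. ?P S"
    then show "\<Union>\<K> \<subseteq> points G" by blast
    have "{x \<in> {0..len G e}. edge_point G e x \<in> \<Union>\<K>} =
      \<Union>((\<lambda>S. {x \<in> {0..len G e}. edge_point G e x \<in> S}) ` \<K>)" for e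
      by auto
    moreover have "openin (top_of_set {0..len G e})
        (\<Union>((\<lambda>S. {x \<in> {0..len G e}. edge_point G e x \<in> S}) ` \<K>))" if "e \<in> edges G" for e
      using K that by (intro openin_Union) blast
    ultimately show "\<forall>e\<in>edges G. openin (top_of_set {0..len G e})
        {x \<in> {0..len G e}. edge_point G e x \<in> \<Union>\<K>}"
      by simp
  qed
  then show ?thesis
    unfolding graph_topology_def by (simp add: topology_inverse')
qed

definition connected_graph :: "('v, 'e) metric_graph \<Rightarrow> bool" where
  "connected_graph G \<longleftrightarrow> path_connected_space (graph_topology G)"


section \<open>Functions on a metric graph\<close>

definition on_edge ::
    "('v, 'e) metric_graph \<Rightarrow> (('v, 'e) point \<Rightarrow> real) \<Rightarrow> 'e \<Rightarrow> real \<Rightarrow> real" where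
  "on_edge G u e = (\<lambda>x. u (edge_point G e x))"

definition graph_integral :: "('v, 'e) metric_graph \<Rightarrow> (('v, 'e) point \<Rightarrow> real) \<Rightarrow> real" where
  "graph_integral G u = (\<Sum>e\<in>edges G. integral\<^sup>L (lebesgue_on {0..len G e}) (on_edge G u e))"

text \<open>The Lebesgue space \<open>L\<^sup>2(0, l)\<close>, on the level of representatives.\<close>

definition in_L2 :: "real \<Rightarrow> (real \<Rightarrow> real) \<Rightarrow> bool" where
  "in_L2 l f \<longleftrightarrow>
     f \<in> borel_measurable (lebesgue_on {0<..<l}) \<and>
     integrable (lebesgue_on {0<..<l}) (\<lambda>x. (f x)\<^sup>2)"

text \<open>
  Weak derivatives on \<open>(0, l)\<close>, tested as in Brezis's treatment of Sobolev spaces on an interval with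
  continuously differentiable functions of compact support in \<open>(0, l)\<close>.
\<close>

definition test_function :: "real \<Rightarrow> (real \<Rightarrow> real) \<Rightarrow> bool" where
  "test_function l \<phi> \<longleftrightarrow> \<phi> C1_differentiable_on UNIV \<and> closure {x. \<phi> x \<noteq> 0} \<subseteq> {0<..<l}"

definition weak_derivative :: "real \<Rightarrow> (real \<Rightarrow> real) \<Rightarrow> (real \<Rightarrow> real) \<Rightarrow> bool" where
  "weak_derivative l f g \<longleftrightarrow>
     (\<forall>\<phi>. test_function l \<phi> \<longrightarrow>
        integral\<^sup>L (lebesgue_on {0<..<l}) (\<lambda>x. f x * deriv \<phi> x) =
        - integral\<^sup>L (lebesgue_on {0<..<l}) (\<lambda>x. g x * \<phi> x))"

text \<open>\<open>f \<in> H\<^sup>2(0, l)\<close> with \<open>f'' = h\<close>, and \<open>f \<in> H\<^sup>2(0, l)\<close>.\<close>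

definition H2_second_derivative :: "real \<Rightarrow> (real \<Rightarrow> real) \<Rightarrow> (real \<Rightarrow> real) \<Rightarrow> bool" where
  "H2_second_derivative l f h \<longleftrightarrow>
     in_L2 l f \<and> in_L2 l h \<and> (\<exists>g. in_L2 l g \<and> weak_derivative l f g \<and> weak_derivative l g h)"

definition in_H2 :: "real \<Rightarrow> (real \<Rightarrow> real) \<Rightarrow> bool" where
  "in_H2 l f \<longleftrightarrow> (\<exists>h. H2_second_derivative l f h)"


section \<open>The Laplacian with delta conditions, torsion function and torsional rigidity\<close>

text \<open>
  The one-sided derivative of \<open>u\<close> along \<open>e\<close> at the end with coordinate \<open>x\<close> (\<open>0\<close> or \<open>len G e\<close>), in the
  direction pointing out of the edge, that is, into the vertex. It exists for a continuous
  representative of an \<open>H\<^sup>2\<close> function, since such a representative is continuously differentiable up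
  to the end points.
\<close>

definition normal_derivative ::
    "('v, 'e) metric_graph \<Rightarrow> (('v, 'e) point \<Rightarrow> real) \<Rightarrow> 'e \<Rightarrow> real \<Rightarrow> real" where
  "normal_derivative G u e x =
     (if x = 0 then -1 else 1) *
     vector_derivative (on_edge G u e) (at x within {0..len G e})"

text \<open>
  Elements of the operator domain are given by their continuous representatives. A function is
  continuous on the glued space iff it is continuous on every closed edge, so \<open>continuous_map\<close>
  combines the choice of representative in the interior of the edges with continuity at the vertices.
\<close>

definition laplacian_domain ::
    "('v, 'e) metric_graph \<Rightarrow> ('v \<Rightarrow> real) \<Rightarrow> (('v, 'e) point \<Rightarrow> real) set" where
  "laplacian_domain G \<alpha> =
     {u. continuous_map (graph_topology G) euclideanreal u \<and>
         (\<forall>e\<in>edges G. in_H2 (len G e) (on_edge G u e)) \<and>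
         (\<forall>v\<in>verts G.
            (\<Sum>(e, x)\<in>incident_ends G v. normal_derivative G u e x) + \<alpha> v * u (Vertex v) = 0)}"

text \<open>\<open>u\<close> lies in the operator domain and \<open>-\<Delta>\<^bsub>G,\<alpha>\<^esub> u = f\<close> as elements of \<open>L\<^sup>2(G)\<close>.\<close>

definition neg_laplacian_eq ::
    "('v, 'e) metric_graph \<Rightarrow> ('v \<Rightarrow> real) \<Rightarrow> (('v, 'e) point \<Rightarrow> real) \<Rightarrow> (('v, 'e) point \<Rightarrow> real) \<Rightarrow> bool"
  where
  "neg_laplacian_eq G \<alpha> u f \<longleftrightarrow>
     u \<in> laplacian_domain G \<alpha> \<and>
     (\<forall>e\<in>edges G. \<exists>h. H2_second_derivative (len G e) (on_edge G u e) h \<and>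
        (AE x in lebesgue_on {0<..<len G e}. - h x = on_edge G f e x))"

text \<open>The solution is unique as a function on \<open>points G\<close>; outside it is fixed by \<open>extensional\<close>.\<close>

definition torsion_function ::
    "('v, 'e) metric_graph \<Rightarrow> ('v \<Rightarrow> real) \<Rightarrow> ('v, 'e) point \<Rightarrow> real" where
  "torsion_function G \<alpha> =
     (THE u. u \<in> extensional (points G) \<and> neg_laplacian_eq G \<alpha> u (\<lambda>_. 1))"

definition torsional_rigidity :: "('v, 'e) metric_graph \<Rightarrow> ('v \<Rightarrow> real) \<Rightarrow> real" where
  "torsional_rigidity G \<alpha> = graph_integral G (torsion_function G \<alpha>)"


section \<open>Merging pendant edges\<close>

text \<open>
  The edges \<open>e 1, \<dots>, e r\<close> and their degree one vertices \<open>v 1, \<dots>, v r\<close> are removed, and an edge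
  \<open>e_hat\<close> from \<open>v0\<close> to \<open>v_hat\<close> of the same total length is added.
\<close>

definition merge_pendant_edges ::
    "('v, 'e) metric_graph \<Rightarrow> nat \<Rightarrow> (nat \<Rightarrow> 'e) \<Rightarrow> (nat \<Rightarrow> 'v) \<Rightarrow> 'v \<Rightarrow> 'e \<Rightarrow> 'v \<Rightarrow>
      ('v, 'e) metric_graph" where
  "merge_pendant_edges G r e v v0 e_hat v_hat =
     \<lparr> verts = (verts G \<union> {v_hat}) - v ` {1..r},
       edges = (edges G - e ` {1..r}) \<union> {e_hat},
       source = (source G)(e_hat := v0),
       target = (target G)(e_hat := v_hat),
       len = (len G)(e_hat := \<Sum>j=1..r. len G (e j)) \<rparr>"

end

theory Submission
  imports Defs
begin

text \<open>
  On an edge of length \<open>l\<close> the torsion function is the quadratic polynomial with second derivative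
  \<open>-1\<close> determined by its values \<open>a, b\<close> at the two ends (du Bois-Reymond), so the torsion problem
  reduces to a positive definite linear system for the vertex values \<open>f\<close>. The torsional rigidity is
  therefore the maximum over \<open>f\<close> of the sum of \<open>l (a + b) - (a - b)\<^sup>2 / l + l\<^sup>3 / 12\<close> over the edges
  minus the sum of \<open>\<alpha> v (f v)\<^sup>2\<close> over the vertices. A pendant edge with value \<open>a\<close> at its inner end
  contributes at most \<open>2 l a + l\<^sup>3 / 3\<close>, with equality for a suitable value at an outer end without
  strength. Merging pendant edges keeps the sum of these \<open>2 l a\<close> and does not decrease the sum of
  the \<open>l\<^sup>3\<close>.
\<close>

section \<open>Weak derivatives\<close>

text \<open>End points form a null set, so the Lebesgue integrals over open intervals in the
  definition of weak derivatives can be computed by calculus on closed intervals.\<close>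

lemma lebesgue_integral_Ioo_eq_integral:
  fixes f :: "real \<Rightarrow> real"
  assumes "continuous_on {a..b} f"
  shows "integrable (lebesgue_on {a<..<b}) f"
    and "integral\<^sup>L (lebesgue_on {a<..<b}) f = integral {a..b} f"
proof -
  have "f absolutely_integrable_on {a<..<b}"
    using absolutely_integrable_continuous_real[OF assms]
    by (rule set_integrable_subset) auto
  then show int: "integrable (lebesgue_on {a<..<b}) f"
    by (intro absolutely_integrable_imp_integrable) auto
  show "integral\<^sup>L (lebesgue_on {a<..<b}) f = integral {a..b} f"
    using int by (simp add: lebesgue_integral_eq_integral integral_open_interval_real)
qed

lemma has_integral_real_derivative:
  fixes F f :: "real \<Rightarrow> real"
  assumes "a \<le> b" "\<And>x. (F has_real_derivative f x) (at x)"
  shows "(f has_integral (F b - F a)) {a..b}"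
proof (rule fundamental_theorem_of_calculus[OF \<open>a \<le> b\<close>])
  show "(F has_vector_derivative f x) (at x within {a..b})" for x
    using assms(2) has_vector_derivative_at_within
    unfolding has_real_derivative_iff_has_vector_derivative by blast
qed

lemma integral_diff_scaled2:
  fixes f g h :: "real \<Rightarrow> real"
  assumes "continuous_on {a..b} f" "continuous_on {a..b} g" "continuous_on {a..b} h"
  shows "integral {a..b} (\<lambda>x. f x - c * g x - d * h x) =
    integral {a..b} f - c * integral {a..b} g - d * integral {a..b} h"
proof (rule integral_unique)
  have "f integrable_on {a..b}" "g integrable_on {a..b}" "h integrable_on {a..b}"
    using assms by (auto intro: integrable_continuous_real)
  then show "((\<lambda>x. f x - c * g x - d * h x) has_integral
      integral {a..b} f - c * integral {a..b} g - d * integral {a..b} h) {a..b}"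
    by (intro has_integral_diff has_integral_mult_right integrable_integral)
qed

lemma test_functionE:
  assumes "test_function l \<phi>"
  obtains "\<And>x. (\<phi> has_real_derivative deriv \<phi> x) (at x)" "continuous_on UNIV (deriv \<phi>)"
    "continuous_on UNIV \<phi>" "\<phi> 0 = 0" "\<phi> l = 0"
proof -
  obtain D where D: "\<And>x. (\<phi> has_vector_derivative D x) (at x)" "continuous_on UNIV D"
    using assms by (auto simp: test_function_def C1_differentiable_on_def)
  have d: "(\<phi> has_real_derivative D x) (at x)" for x
    using D(1) by (simp add: has_real_derivative_iff_has_vector_derivative)
  then have "deriv \<phi> = D"
    by (auto intro: DERIV_imp_deriv)
  moreover have "continuous_on UNIV \<phi>"
    using d by (meson DERIV_isCont continuous_at_imp_continuous_on)
  moreover have "\<phi> 0 = 0" "\<phi> l = 0"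
    using assms closure_subset[of "{x. \<phi> x \<noteq> 0}"] by (force simp: test_function_def)+
  ultimately show ?thesis
    using that d D(2) by auto
qed

text \<open>Integration by parts; the boundary terms vanish because a test function is zero at
  \<open>0\<close> and \<open>l\<close>.\<close>

lemma weak_derivative_classical:
  assumes "0 < l" and f: "\<And>x. (f has_real_derivative g x) (at x)" and g: "continuous_on UNIV g"
  shows "weak_derivative l f g"
  unfolding weak_derivative_def
proof (intro allI impI)
  fix \<phi> assume "test_function l \<phi>"
  then obtain \<phi>: "\<And>x. (\<phi> has_real_derivative deriv \<phi> x) (at x)" "continuous_on UNIV (deriv \<phi>)"
    "continuous_on UNIV \<phi>" "\<phi> 0 = 0" "\<phi> l = 0"
    by (rule test_functionE) blast
  have "continuous_on UNIV f"
    using f by (meson DERIV_isCont continuous_at_imp_continuous_on)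
  then have c: "continuous_on {0..l} (\<lambda>x. f x * deriv \<phi> x)" "continuous_on {0..l} (\<lambda>x. g x * \<phi> x)"
    using g \<phi>(2,3) by (auto intro!: continuous_on_mult intro: continuous_on_subset)
  have "((\<lambda>x. f x * \<phi> x) has_real_derivative f x * deriv \<phi> x + g x * \<phi> x) (at x)" for x
    using DERIV_mult'[OF f \<phi>(1)] .
  then have "((\<lambda>x. f x * deriv \<phi> x + g x * \<phi> x) has_integral (f l * \<phi> l - f 0 * \<phi> 0)) {0..l}"
    using has_integral_real_derivative[of 0 l "\<lambda>x. f x * \<phi> x"] \<open>0 < l\<close> by simp
  then have "integral {0..l} (\<lambda>x. f x * deriv \<phi> x) + integral {0..l} (\<lambda>x. g x * \<phi> x) = 0"
    using \<phi>(4,5) integrable_continuous_real[OF c(1)] integrable_continuous_real[OF c(2)]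
    by (simp add: has_integral_iff Henstock_Kurzweil_Integration.integral_add)
  then show "integral\<^sup>L (lebesgue_on {0<..<l}) (\<lambda>x. f x * deriv \<phi> x) =
      - integral\<^sup>L (lebesgue_on {0<..<l}) (\<lambda>x. g x * \<phi> x)"
    using c by (simp add: lebesgue_integral_Ioo_eq_integral)
qed

lemma in_L2_continuous:
  assumes "continuous_on {0..l} f"
  shows "in_L2 l f"
  using lebesgue_integral_Ioo_eq_integral(1)[OF assms]
    lebesgue_integral_Ioo_eq_integral(1)[OF continuous_on_power[OF assms, of 2]]
  by (auto simp: in_L2_def)

lemma in_L2_cong:
  assumes "in_L2 l f" "\<And>x. x \<in> {0<..<l} \<Longrightarrow> f x = g x"
  shows "in_L2 l g"
proof -
  have "f \<in> borel_measurable (lebesgue_on {0<..<l}) \<longleftrightarrow> g \<in> borel_measurable (lebesgue_on {0<..<l})"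
    using assms(2) by (intro measurable_cong) auto
  moreover have "integrable (lebesgue_on {0<..<l}) (\<lambda>x. (f x)\<^sup>2) \<longleftrightarrow>
      integrable (lebesgue_on {0<..<l}) (\<lambda>x. (g x)\<^sup>2)"
    using assms(2) by (intro Bochner_Integration.integrable_cong) auto
  ultimately show ?thesis
    using assms(1) by (simp add: in_L2_def)
qed

lemma weak_derivative_cong:
  assumes "weak_derivative l f g" "\<And>x. x \<in> {0<..<l} \<Longrightarrow> f x = f' x"
  shows "weak_derivative l f' g"
proof -
  have "integral\<^sup>L (lebesgue_on {0<..<l}) (\<lambda>x. f x * deriv \<phi> x) =
      integral\<^sup>L (lebesgue_on {0<..<l}) (\<lambda>x. f' x * deriv \<phi> x)" for \<phi>
    using assms(2) by (intro Bochner_Integration.integral_cong) auto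
  then show ?thesis
    using assms(1) by (simp add: weak_derivative_def)
qed

lemma H2_second_derivative_cong:
  assumes "H2_second_derivative l f h" "\<And>x. x \<in> {0<..<l} \<Longrightarrow> f x = f' x"
  shows "H2_second_derivative l f' h"
  using assms in_L2_cong weak_derivative_cong unfolding H2_second_derivative_def by metis

lemma H2_second_derivative_quadratic:
  assumes "0 < l"
  shows "H2_second_derivative l (\<lambda>x. c + b * x - x\<^sup>2 / 2) (\<lambda>_. -1)"
proof -
  have "weak_derivative l (\<lambda>x. c + b * x - x\<^sup>2 / 2) (\<lambda>x. b - x)"
    "weak_derivative l (\<lambda>x. b - x) (\<lambda>_. -1)"
    using assms by (auto intro!: weak_derivative_classical derivative_eq_intros continuous_intros)
  then show ?thesis
    unfolding H2_second_derivative_def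
    by (intro conjI exI[of _ "\<lambda>x. b - x"]) (auto intro!: in_L2_continuous continuous_intros)
qed

section \<open>Du Bois-Reymond lemma of second order\<close>

lemma test_functionI:
  assumes f: "\<And>x. (\<phi> has_real_derivative \<psi> x) (at x)" "continuous_on UNIV \<psi>"
    and ab: "0 < a" "b < l" and z: "\<And>x. x \<notin> {a..b} \<Longrightarrow> \<phi> x = 0"
  shows "test_function l \<phi>" "deriv \<phi> = \<psi>"
proof -
  have "{x. \<phi> x \<noteq> 0} \<subseteq> {a..b}"
    using z by blast
  then have "closure {x. \<phi> x \<noteq> 0} \<subseteq> {a..b}"
    by (intro closure_minimal) auto
  with ab have "closure {x. \<phi> x \<noteq> 0} \<subseteq> {0<..<l}"
    by fastforce
  then show "test_function l \<phi>"
    using f by (auto simp: test_function_def C1_differentiable_on_def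
        has_real_derivative_iff_has_vector_derivative)
  show "deriv \<phi> = \<psi>"
    using f by (auto intro: DERIV_imp_deriv)
qed

text \<open>Any primitive is constant on each side of \<open>{a..b}\<close>. Normalise it to vanish
  at \<open>a\<close>; the zero mean of \<open>f\<close> makes it vanish at \<open>b\<close>, hence
  to the right as well.\<close>

lemma antiderivative_compact_support:
  fixes f :: "real \<Rightarrow> real"
  assumes "a < b" and f: "continuous_on UNIV f" and z: "\<And>x. x \<notin> {a..b} \<Longrightarrow> f x = 0"
    and "integral {a..b} f = 0"
  obtains F where "\<And>x. (F has_real_derivative f x) (at x)" "\<And>x. x \<notin> {a..b} \<Longrightarrow> F x = 0"
    "F a = 0" "F b = 0"
proof -
  have "\<exists>F. \<forall>x::real. - \<infinity> < ereal x \<longrightarrow> ereal x < \<infinity> \<longrightarrow> (F has_vector_derivative f x) (at x)"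
    using f by (intro einterval_antiderivative) (auto simp: continuous_on_eq_continuous_at)
  then obtain F0 where F0: "\<And>x. (F0 has_real_derivative f x) (at x)"
    by (auto simp: has_real_derivative_iff_has_vector_derivative)
  define F where "F = (\<lambda>x. F0 x - F0 a)"
  have F: "(F has_real_derivative f x) (at x)" for x
    unfolding F_def by (auto intro!: derivative_eq_intros F0)
  have "(f has_integral (F b - F a)) {a..b}"
    using \<open>a < b\<close> F by (intro has_integral_real_derivative) auto
  then have ab: "F b = F a"
    using assms(4) by (simp add: has_integral_iff)
  have cont: "continuous_on S F" for S
    using F by (meson DERIV_isCont continuous_at_imp_continuous_on)
  have out: "F x = 0" if x: "x \<notin> {a..b}" for x
  proof (cases "x < a")
    case True
    have "F a = F x"
    proof (rule DERIV_isconst2[OF True cont])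
      show "(F has_real_derivative 0) (at y)" if "x < y" "y < a" for y
        using F[of y] z[of y] that by simp
    qed (use True in auto)
    then show ?thesis by (simp add: F_def)
  next
    case False
    then have "b < x" using x by auto
    have "F x = F b"
    proof (rule DERIV_isconst2[OF \<open>b < x\<close> cont])
      show "(F has_real_derivative 0) (at y)" if "b < y" "y < x" for y
        using F[of y] z[of y] that by simp
    qed (use \<open>b < x\<close> in auto)
    then show ?thesis using ab by (simp add: F_def)
  qed
  show ?thesis
    by (rule that[OF F out]) (use ab in \<open>simp_all add: F_def\<close>)
qed

text \<open>
  The second derivative of the test function is a projection of \<open>p\<close> itself: with the weight
  \<open>\<omega> x = (x - a) (b - x)\<close>, which makes it continuous at \<open>a\<close> and \<open>b\<close>, subtract from \<open>p\<close> its
  \<open>\<omega>\<close>-orthogonal projection to the affine functions. Orthogonality to \<open>1\<close> and \<open>x\<close> is what makes the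
  two iterated primitives compactly supported.
\<close>

lemma affine_if_weakly_affine_Icc:
  fixes p :: "real \<Rightarrow> real"
  assumes "a < b" and p: "continuous_on UNIV p"
    and weak: "\<And>\<phi> \<psi> \<rho>. \<lbrakk>\<And>x. (\<phi> has_real_derivative \<psi> x) (at x);
      \<And>x. (\<psi> has_real_derivative \<rho> x) (at x); continuous_on UNIV \<rho>;
      \<And>x. x \<notin> {a..b} \<Longrightarrow> \<phi> x = 0; \<And>x. x \<notin> {a..b} \<Longrightarrow> \<psi> x = 0; \<And>x. x \<notin> {a..b} \<Longrightarrow> \<rho> x = 0\<rbrakk>
      \<Longrightarrow> integral {a..b} (\<lambda>x. p x * \<rho> x) = 0"
  obtains c0 c1 where "\<And>x. x \<in> {a<..<b} \<Longrightarrow> p x = c0 + c1 * x"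
proof -
  define m where "m = (a + b) / 2"
  define \<omega> where "\<omega> = (\<lambda>x. max 0 ((x - a) * (b - x)))"
  have \<omega>_in: "\<omega> x = (x - a) * (b - x)" if "x \<in> {a..b}" for x
    using that by (simp add: \<omega>_def)
  have \<omega>_out: "\<omega> x = 0" if "x \<notin> {a..b}" for x
    using that \<open>a < b\<close> by (auto simp: \<omega>_def max_def zero_le_mult_iff)
  have \<omega>_pos: "0 < \<omega> x" if "x \<in> {a<..<b}" for x
    using that by (simp add: \<omega>_def)
  have \<omega>_nn: "0 \<le> \<omega> x" for x
    by (simp add: \<omega>_def)
  have c\<omega>: "continuous_on S \<omega>" for S
    unfolding \<omega>_def by (intro continuous_intros)
  have cp: "continuous_on S p" for S
    using p continuous_on_subset by blast
  \<comment> \<open>The weight is even about the midpoint \<open>m\<close>, so \<open>1\<close> and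
    \<open>x - m\<close> are orthogonal and the coefficients \<open>c0\<close>, \<open>c1\<close> of
    the projection decouple.\<close>
  have odd: "integral {a..b} (\<lambda>x. \<omega> x * (x - m)) = 0"
  proof -
    have "((\<lambda>x. (x - a) * (b - x) * (x - m)) has_integral
        (- ((b - a) * (b - b))\<^sup>2 / 4) - (- ((a - a) * (b - a))\<^sup>2 / 4)) {a..b}"
      using \<open>a < b\<close>
      by (intro has_integral_real_derivative[of a b "\<lambda>x. - ((x - a) * (b - x))\<^sup>2 / 4"])
        (auto simp: m_def field_simps power2_eq_square intro!: derivative_eq_intros)
    then have "integral {a..b} (\<lambda>x. (x - a) * (b - x) * (x - m)) = 0"
      by (simp add: has_integral_iff)
    moreover have "integral {a..b} (\<lambda>x. \<omega> x * (x - m)) = integral {a..b} (\<lambda>x. (x - a) * (b - x) * (x - m))"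
      by (intro Henstock_Kurzweil_Integration.integral_cong) (simp add: \<omega>_in)
    ultimately show ?thesis by simp
  qed
  have "m \<in> {a<..<b}"
    using \<open>a < b\<close> by (simp add: m_def)
  \<comment> \<open>The integrand of \<open>M\<close> vanishes at \<open>m\<close> itself, so
    positivity of \<open>M\<close> is seen at another interior point.\<close>
  then obtain n where "m < n" "n < b"
    using dense[of m b] by auto
  with \<open>m \<in> _\<close> have n: "n \<in> {a<..<b}" "n \<noteq> m"
    by auto
  define W where "W = integral {a..b} \<omega>"
  define M where "M = integral {a..b} (\<lambda>x. \<omega> x * (x - m)\<^sup>2)"
  have "W \<noteq> 0"
  proof
    assume "W = 0"
    then have "\<forall>x\<in>{a..b}. \<omega> x = 0"
      using integral_eq_0_iff[of a b \<omega>] \<omega>_nn c\<omega> \<open>a < b\<close> by (simp add: W_def)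
    then show False
      using \<omega>_pos[of m] \<open>m \<in> _\<close> by force
  qed
  have "M \<noteq> 0"
  proof
    assume "M = 0"
    then have "\<forall>x\<in>{a..b}. \<omega> x * (x - m)\<^sup>2 = 0"
      using integral_eq_0_iff[of a b "\<lambda>x. \<omega> x * (x - m)\<^sup>2"] \<omega>_nn \<open>a < b\<close>
      by (simp add: M_def continuous_intros c\<omega>)
    then show False
      using \<omega>_pos[OF n(1)] n by force
  qed
  define c0 where "c0 = integral {a..b} (\<lambda>x. \<omega> x * p x) / W"
  define c1 where "c1 = integral {a..b} (\<lambda>x. \<omega> x * (x - m) * p x) / M"
  define q where "q = (\<lambda>x. p x - c0 - c1 * (x - m))"
  define \<rho> where "\<rho> = (\<lambda>x. \<omega> x * q x)"
  have cq: "continuous_on S q" and c\<rho>: "continuous_on S \<rho>" for S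
    unfolding \<rho>_def q_def by (intro continuous_intros c\<omega> cp)+
  have mom0: "integral {a..b} \<rho> = 0"
  proof -
    have "integral {a..b} \<rho> =
        integral {a..b} (\<lambda>x. \<omega> x * p x - c0 * \<omega> x - c1 * (\<omega> x * (x - m)))"
      by (intro Henstock_Kurzweil_Integration.integral_cong) (simp add: \<rho>_def q_def algebra_simps)
    also have "\<dots> = integral {a..b} (\<lambda>x. \<omega> x * p x) - c0 * W - c1 * 0"
      unfolding W_def odd[symmetric]
      by (intro integral_diff_scaled2 continuous_intros c\<omega> cp)
    finally show ?thesis
      using \<open>W \<noteq> 0\<close> by (simp add: c0_def)
  qed
  have mom1: "integral {a..b} (\<lambda>x. (x - m) * \<rho> x) = 0"
  proof -
    have "integral {a..b} (\<lambda>x. (x - m) * \<rho> x) =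
        integral {a..b} (\<lambda>x. \<omega> x * (x - m) * p x - c0 * (\<omega> x * (x - m)) - c1 * (\<omega> x * (x - m)\<^sup>2))"
      by (intro Henstock_Kurzweil_Integration.integral_cong)
        (simp add: \<rho>_def q_def algebra_simps power2_eq_square)
    also have "\<dots> = integral {a..b} (\<lambda>x. \<omega> x * (x - m) * p x) - c0 * 0 - c1 * M"
      unfolding M_def odd[symmetric]
      by (intro integral_diff_scaled2 continuous_intros c\<omega> cp)
    finally show ?thesis
      using \<open>M \<noteq> 0\<close> by (simp add: c1_def)
  qed
  have \<rho>0: "\<rho> x = 0" if "x \<notin> {a..b}" for x
    using that by (simp add: \<rho>_def \<omega>_out)
  obtain \<psi> where \<psi>: "\<And>x. (\<psi> has_real_derivative \<rho> x) (at x)" "\<And>x. x \<notin> {a..b} \<Longrightarrow> \<psi> x = 0"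
    "\<psi> a = 0" "\<psi> b = 0"
    using antiderivative_compact_support[OF \<open>a < b\<close> c\<rho> \<rho>0 mom0] by blast
  have c\<psi>: "continuous_on S \<psi>" for S
    using \<psi>(1) by (meson DERIV_isCont continuous_at_imp_continuous_on)
  \<comment> \<open>Integrating by parts, the mean of \<psi> is minus the first moment of \<rho>
    about \<open>m\<close>, so \<open>mom1\<close> is what allows a second compactly supported
    primitive.\<close>
  have int_\<psi>: "integral {a..b} \<psi> = 0"
  proof -
    have "((\<lambda>x. (x - m) * \<rho> x + \<psi> x) has_integral ((b - m) * \<psi> b - (a - m) * \<psi> a)) {a..b}"
      using \<open>a < b\<close>
      by (intro has_integral_real_derivative[of a b "\<lambda>x. (x - m) * \<psi> x"])
        (auto intro!: derivative_eq_intros \<psi>(1))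
    moreover have "integral {a..b} (\<lambda>x. (x - m) * \<rho> x + \<psi> x) =
        integral {a..b} (\<lambda>x. (x - m) * \<rho> x) + integral {a..b} \<psi>"
      by (intro Henstock_Kurzweil_Integration.integral_add integrable_continuous_real
          continuous_intros c\<psi> c\<rho>)
    ultimately show ?thesis
      using mom1 \<psi>(3,4) by (simp add: has_integral_iff)
  qed
  obtain \<phi> where \<phi>: "\<And>x. (\<phi> has_real_derivative \<psi> x) (at x)" "\<And>x. x \<notin> {a..b} \<Longrightarrow> \<phi> x = 0"
    "\<phi> a = 0" "\<phi> b = 0"
    using antiderivative_compact_support[OF \<open>a < b\<close> c\<psi> \<psi>(2) int_\<psi>] by blast
  have p\<rho>: "integral {a..b} (\<lambda>x. p x * \<rho> x) = 0"
    by (rule weak[OF \<phi>(1) \<psi>(1) c\<rho> \<phi>(2) \<psi>(2) \<rho>0])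
  \<comment> \<open>The left side is the integral of \<open>q\<close> against \<rho>. Since
    \<open>q\<close> is \<open>p\<close> minus an affine function and \<rho> annihilates both, it is
    zero; so \<open>q\<close> vanishes wherever the weight is positive.\<close>
  have "integral {a..b} (\<lambda>x. \<omega> x * (q x)\<^sup>2) =
      integral {a..b} (\<lambda>x. p x * \<rho> x - c0 * \<rho> x - c1 * ((x - m) * \<rho> x))"
    by (intro Henstock_Kurzweil_Integration.integral_cong)
      (simp add: \<rho>_def q_def algebra_simps power2_eq_square)
  also have "\<dots> = integral {a..b} (\<lambda>x. p x * \<rho> x) - c0 * integral {a..b} \<rho> -
      c1 * integral {a..b} (\<lambda>x. (x - m) * \<rho> x)"
    by (intro integral_diff_scaled2 continuous_intros c\<rho> cp)
  also have "\<dots> = 0"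
    by (simp add: p\<rho> mom0 mom1)
  finally have "integral {a..b} (\<lambda>x. \<omega> x * (q x)\<^sup>2) = 0" .
  then have *: "\<forall>x\<in>{a..b}. \<omega> x * (q x)\<^sup>2 = 0"
    using integral_eq_0_iff[of a b "\<lambda>x. \<omega> x * (q x)\<^sup>2"] \<omega>_nn \<open>a < b\<close>
    by (simp add: continuous_intros c\<omega> cq)
  have "p x = (c0 - c1 * m) + c1 * x" if "x \<in> {a<..<b}" for x
    using *[rule_format, of x] \<omega>_pos[OF that] that by (auto simp: q_def algebra_simps)
  then show ?thesis
    using that by blast
qed

text \<open>Test functions live on compact subintervals of the open interval, so the local result
  gives an affine formula on each of these. The formulas agree wherever two common points fix them,
  and continuity extends the result to \<open>0\<close> and \<open>l\<close>.\<close>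

lemma affine_if_weakly_affine:
  fixes p :: "real \<Rightarrow> real"
  assumes "0 < l" and p: "continuous_on {0..l} p"
    and weak: "\<And>\<phi> \<psi> \<rho>. \<lbrakk>test_function l \<phi>; test_function l \<psi>; continuous_on UNIV \<rho>;
      deriv \<phi> = \<psi>; deriv \<psi> = \<rho>\<rbrakk> \<Longrightarrow> integral {0..l} (\<lambda>x. p x * \<rho> x) = 0"
  obtains c0 c1 where "\<And>x. x \<in> {0..l} \<Longrightarrow> p x = c0 + c1 * x"
proof -
  \<comment> \<open>Constant continuation beyond the ends, since the local result asks for
    continuity on the whole line.\<close>
  define P where "P = (\<lambda>x. p (max 0 (min l x)))"
  have P: "P x = p x" if "x \<in> {0..l}" for x
    using that by (simp add: P_def)
  have cP: "continuous_on UNIV P"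
    unfolding P_def
    by (rule continuous_on_compose2[OF p]) (use \<open>0 < l\<close> in \<open>auto intro!: continuous_intros\<close>)
  have aff: "\<exists>c0 c1. \<forall>x\<in>{a<..<b}. p x = c0 + c1 * x" if ab: "0 < a" "a < b" "b < l" for a b
  proof -
    obtain c0 c1 where "\<And>x. x \<in> {a<..<b} \<Longrightarrow> P x = c0 + c1 * x"
    proof (rule affine_if_weakly_affine_Icc[OF \<open>a < b\<close> cP])
      fix \<phi> \<psi> \<rho> :: "real \<Rightarrow> real"
      assume \<phi>: "\<And>x. (\<phi> has_real_derivative \<psi> x) (at x)"
        and \<psi>: "\<And>x. (\<psi> has_real_derivative \<rho> x) (at x)" and \<rho>: "continuous_on UNIV \<rho>"
        and z: "\<And>x. x \<notin> {a..b} \<Longrightarrow> \<phi> x = 0" "\<And>x. x \<notin> {a..b} \<Longrightarrow> \<psi> x = 0"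
          "\<And>x. x \<notin> {a..b} \<Longrightarrow> \<rho> x = 0"
      have c\<psi>: "continuous_on UNIV \<psi>"
        using \<psi> by (meson DERIV_isCont continuous_at_imp_continuous_on)
      have "integral {0..l} (\<lambda>x. p x * \<rho> x) = 0"
        using test_functionI[OF \<phi> c\<psi> \<open>0 < a\<close> \<open>b < l\<close> z(1)]
          test_functionI[OF \<psi> \<rho> \<open>0 < a\<close> \<open>b < l\<close> z(2)] \<rho> by (intro weak)
      moreover have "integral {a..b} (\<lambda>x. P x * \<rho> x) = integral {a..b} (\<lambda>x. p x * \<rho> x)"
        using ab by (intro Henstock_Kurzweil_Integration.integral_cong) (simp add: P)
      moreover have "integral {a..b} (\<lambda>x. p x * \<rho> x) = integral {0..l} (\<lambda>x. p x * \<rho> x)"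
      proof (rule integral_unique[symmetric, OF has_integral_on_superset[OF integrable_integral]])
        show "(\<lambda>x. p x * \<rho> x) integrable_on {a..b}"
          using ab \<rho> by (intro integrable_continuous_real continuous_on_mult continuous_on_subset[OF p]
              continuous_on_subset[OF \<rho>]) auto
        show "p x * \<rho> x = 0" if "x \<notin> {a..b}" for x
          using z(3)[OF that] by simp
      qed (use ab in auto)
      ultimately show "integral {a..b} (\<lambda>x. P x * \<rho> x) = 0"
        by simp
    qed blast
    then show ?thesis
      using P ab by (intro exI[of _ c0] exI[of _ c1]) auto
  qed
  \<comment> \<open>Two fixed points: each \<open>x\<close> is put into a subinterval that also
    contains \<open>s\<close> and \<open>t\<close>, so slope and intercept do not depend on
    \<open>x\<close>.\<close>
  define s t where "s = l / 3" and "t = 2 * l / 3"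
  have st: "0 < s" "s < t" "t < l"
    using \<open>0 < l\<close> by (auto simp: s_def t_def)
  define c1 where "c1 = (p t - p s) / (t - s)"
  define c0 where "c0 = p s - c1 * s"
  have inner: "p x - c1 * x = c0" if x: "x \<in> {0<..<l}" for x
  proof -
    have "0 < min x s / 2" "min x s / 2 < (max x t + l) / 2" "(max x t + l) / 2 < l"
      using x st by auto
    then obtain d0 d1 where d: "\<And>y. y \<in> {min x s / 2<..<(max x t + l) / 2} \<Longrightarrow> p y = d0 + d1 * y"
      using aff by blast
    have px: "p x = d0 + d1 * x" and ps: "p s = d0 + d1 * s" and pt: "p t = d0 + d1 * t"
      using x st by (auto intro!: d)
    have "c1 = d1"
      using st unfolding c1_def ps pt by (simp add: field_simps)
    then show ?thesis
      by (simp add: c0_def px ps)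
  qed
  have "continuous_on {0..l} (\<lambda>x. p x - c1 * x)"
    by (intro continuous_intros p)
  then have "p x - c1 * x = c0" if "x \<in> {0..l}" for x
    using continuous_constant_on_closure[of "{0<..<l}" "\<lambda>x. p x - c1 * x" c0 x]
      inner that \<open>0 < l\<close> by auto
  then show ?thesis
    using that[of c0 c1] by (simp add: algebra_simps)
qed

text \<open>Adding \<open>x\<^sup>2 / 2\<close> cancels the second derivative \<open>-1\<close>, so
  the sum is weakly affine and hence affine. Continuity of \<open>f\<close> selects the
  representative, which gives the formula at every point and not just almost everywhere.\<close>

lemma H2_second_derivative_minus_one_imp_quadratic:
  assumes "0 < l" and f: "continuous_on {0..l} f"
    and H: "H2_second_derivative l f h" and h: "AE x in lebesgue_on {0<..<l}. - h x = 1"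
  obtains c b where "\<And>x. x \<in> {0..l} \<Longrightarrow> f x = c + b * x - x\<^sup>2 / 2"
proof -
  obtain g where g: "weak_derivative l f g" "weak_derivative l g h" and L2: "in_L2 l h"
    using H by (auto simp: H2_second_derivative_def)
  have sq: "weak_derivative l (\<lambda>x. x\<^sup>2 / 2) (\<lambda>x. x)" "weak_derivative l (\<lambda>x. x) (\<lambda>_. 1)"
    using \<open>0 < l\<close> by (auto intro!: weak_derivative_classical derivative_eq_intros continuous_intros)
  obtain c b where "\<And>x. x \<in> {0..l} \<Longrightarrow> f x + x\<^sup>2 / 2 = c + b * x"
  proof (rule affine_if_weakly_affine[OF \<open>0 < l\<close>])
    show "continuous_on {0..l} (\<lambda>x. f x + x\<^sup>2 / 2)"
      by (intro continuous_intros f) auto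
    fix \<phi> \<psi> \<rho>
    assume \<phi>: "test_function l \<phi>" and \<psi>: "test_function l \<psi>" and \<rho>: "continuous_on UNIV \<rho>"
      and d: "deriv \<phi> = \<psi>" "deriv \<psi> = \<rho>"
    have c\<rho>: "continuous_on {0..l} \<rho>"
      using \<rho> continuous_on_subset by blast
    have m\<phi>: "\<phi> \<in> borel_measurable (lebesgue_on {0<..<l})"
      using \<phi> by (auto elim!: test_functionE intro!: borel_measurable_continuous_onI
          measurable_restrict_space1 measurable_completion)
    let ?I = "integral\<^sup>L (lebesgue_on {0<..<l})"
    \<comment> \<open>The weak derivative is used twice, first tested with \<psi> and then with
      \<phi>; the two minus signs cancel.\<close>
    have "?I (\<lambda>x. f x * \<rho> x) = ?I (\<lambda>x. h x * \<phi> x)"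
      using g \<phi> \<psi> d unfolding weak_derivative_def by force
    also have "\<dots> = ?I (\<lambda>x. - (1 * \<phi> x))"
      using L2 m\<phi> h by (intro integral_cong_AE) (auto simp: in_L2_def)
    also have "\<dots> = - ?I (\<lambda>x. 1 * \<phi> x)"
      by (rule integral_minus)
    also have "?I (\<lambda>x. 1 * \<phi> x) = ?I (\<lambda>x. x\<^sup>2 / 2 * \<rho> x)"
      using sq \<phi> \<psi> d unfolding weak_derivative_def by force
    finally have "?I (\<lambda>x. f x * \<rho> x) + ?I (\<lambda>x. x\<^sup>2 / 2 * \<rho> x) = 0"
      by simp
    moreover have c: "continuous_on {0..l} (\<lambda>x. f x * \<rho> x)"
      "continuous_on {0..l} (\<lambda>x. x\<^sup>2 / 2 * \<rho> x)"
      by (intro continuous_intros f c\<rho>; simp)+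
    ultimately show "integral {0..l} (\<lambda>x. (f x + x\<^sup>2 / 2) * \<rho> x) = 0"
      using c[THEN integrable_continuous_real] c[THEN lebesgue_integral_Ioo_eq_integral(2)]
      by (simp add: distrib_right Henstock_Kurzweil_Integration.integral_add)
  qed blast
  then show ?thesis
    using that[of c b] by (simp add: algebra_simps)
qed

section \<open>The glued space\<close>

lemma edge_point_in_points:
  assumes "metric_graph G" "e \<in> edges G" "x \<in> {0..len G e}"
  shows "edge_point G e x \<in> points G"
  using assms by (auto simp: metric_graph_def edge_point_def points_def)

lemma topspace_graph_topology:
  assumes "metric_graph G"
  shows "topspace (graph_topology G) = points G"
proof
  have "{x \<in> {0..len G e}. edge_point G e x \<in> points G} = {0..len G e}" if "e \<in> edges G" for e
    using edge_point_in_points[OF assms that] by auto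
  then have "openin (graph_topology G) (points G)"
    by (simp add: openin_graph_topology)
  then show "points G \<subseteq> topspace (graph_topology G)"
    by (rule openin_subset)
  show "topspace (graph_topology G) \<subseteq> points G"
    using openin_topspace[of "graph_topology G"] unfolding openin_graph_topology by blast
qed

text \<open>Universal property of the quotient topology: pulling a preimage under \<open>u\<close>
  back along the gluing map gives the preimage under \<open>on_edge G u e\<close>.\<close>

lemma continuous_map_graph_topology_iff:
  assumes "metric_graph G"
  shows "continuous_map (graph_topology G) euclideanreal u \<longleftrightarrow>
    (\<forall>e\<in>edges G. continuous_on {0..len G e} (on_edge G u e))"
proof -
  have "{x \<in> {0..len G e}. edge_point G e x \<in> {p \<in> points G. u p \<in> U}} =
      {0..len G e} \<inter> on_edge G u e -` U" if "e \<in> edges G" for e U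
    using edge_point_in_points[OF assms that] by (auto simp: on_edge_def)
  then show ?thesis
    unfolding continuous_map_def continuous_openin_preimage_eq
    by (auto simp: openin_graph_topology topspace_graph_topology[OF assms])
qed

text \<open>Extend \<open>f\<close> to the glued space, constant along each edge. Every preimage
  under the extension is open, so two different vertex values would separate the space.\<close>

lemma connected_graph_locally_constant:
  assumes G: "metric_graph G" and "connected_graph G"
    and f: "\<And>e. e \<in> edges G \<Longrightarrow> f (source G e) = (f (target G e) :: real)"
    and vw: "v \<in> verts G" "w \<in> verts G"
  shows "f v = f w"
proof (rule ccontr)
  assume ne: "f v \<noteq> f w"
  define h where "h = (\<lambda>p. case p of Vertex v \<Rightarrow> f v | Interior e x \<Rightarrow> f (source G e))"
  have h: "h (edge_point G e x) = f (source G e)" if "e \<in> edges G" for e x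
    using f[OF that] by (simp add: h_def edge_point_def)
  have "openin (graph_topology G) {p \<in> points G. h p \<in> A}" for A
  proof -
    have "{x \<in> {0..len G e}. edge_point G e x \<in> {p \<in> points G. h p \<in> A}} =
        (if f (source G e) \<in> A then {0..len G e} else {})" if "e \<in> edges G" for e
      using edge_point_in_points[OF G that] h[OF that] by auto
    then show ?thesis
      by (auto simp: openin_graph_topology)
  qed
  from this[of "{f v}"] this[of "- {f v}"]
  have "openin (graph_topology G) {p \<in> points G. h p = f v}"
    "openin (graph_topology G) {p \<in> points G. h p \<noteq> f v}"
    by simp_all
  moreover have "Vertex v \<in> {p \<in> points G. h p = f v}" "Vertex w \<in> {p \<in> points G. h p \<noteq> f v}"
    using vw ne by (auto simp: points_def h_def)
  moreover have "topspace (graph_topology G) \<subseteq> {p \<in> points G. h p = f v} \<union> {p \<in> points G. h p \<noteq> f v}"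
    by (auto simp: topspace_graph_topology[OF G])
  moreover have "connected_space (graph_topology G)"
    using assms(2) by (simp add: connected_graph_def path_connected_imp_connected_space)
  ultimately show False
    unfolding connected_space_def by blast
qed

section \<open>Reduction to the vertices\<close>

text \<open>The energy form of the edgewise affine interpolations of \<open>f\<close> and
  \<open>g\<close>, with the strengths as vertex masses: a discrete Laplacian with conductances
  \<open>1 / len G e\<close>.\<close>

definition dirichlet_form ::
    "('v, 'e) metric_graph \<Rightarrow> ('v \<Rightarrow> real) \<Rightarrow> ('v \<Rightarrow> real) \<Rightarrow> ('v \<Rightarrow> real) \<Rightarrow> real" where
  "dirichlet_form G \<alpha> f g =
     (\<Sum>e\<in>edges G. (f (source G e) - f (target G e)) * (g (source G e) - g (target G e)) / len G e) +
     (\<Sum>v\<in>verts G. \<alpha> v * f v * g v)"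

text \<open>The integral over the graph of the edgewise affine interpolation of
  \<open>f\<close>.\<close>

definition trapezoid_sum :: "('v, 'e) metric_graph \<Rightarrow> ('v \<Rightarrow> real) \<Rightarrow> real" where
  "trapezoid_sum G f = (\<Sum>e\<in>edges G. len G e * (f (source G e) + f (target G e)) / 2)"

text \<open>The weak form of the torsion equation, tested with edgewise affine functions.\<close>

definition discrete_torsion :: "('v, 'e) metric_graph \<Rightarrow> ('v \<Rightarrow> real) \<Rightarrow> ('v \<Rightarrow> real) \<Rightarrow> bool" where
  "discrete_torsion G \<alpha> f \<longleftrightarrow> (\<forall>g. dirichlet_form G \<alpha> f g = trapezoid_sum G g)"

text \<open>The solution of \<open>- u'' = 1\<close> on the edge \<open>e\<close> with the values of \<open>f\<close> at the end points.\<close>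

definition edge_torsion :: "('v, 'e) metric_graph \<Rightarrow> ('v \<Rightarrow> real) \<Rightarrow> 'e \<Rightarrow> real \<Rightarrow> real" where
  "edge_torsion G f e x =
     f (source G e) + ((f (target G e) - f (source G e)) / len G e + len G e / 2) * x - x\<^sup>2 / 2"

lemma edge_torsion_ends:
  assumes "0 < len G e"
  shows "edge_torsion G f e 0 = f (source G e)" "edge_torsion G f e (len G e) = f (target G e)"
  using assms by (auto simp: edge_torsion_def power2_eq_square field_simps)

text \<open>With \<open>l\<close> for \<open>len G e\<close>, the edge solution is the affine
  interpolation of its end values plus \<open>x * (l - x) / 2\<close>, and the latter has integral
  \<open>l ^ 3 / 12\<close>.\<close>

lemma integral_edge_torsion:
  assumes "0 < len G e"
  shows "integral\<^sup>L (lebesgue_on {0..len G e}) (edge_torsion G f e) =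
    len G e * (f (source G e) + f (target G e)) / 2 + len G e ^ 3 / 12"
proof -
  define b where "b = (f (target G e) - f (source G e)) / len G e + len G e / 2"
  have "continuous_on {0..len G e} (edge_torsion G f e)"
    unfolding edge_torsion_def by (intro continuous_intros) auto
  then have "integral\<^sup>L (lebesgue_on {0..len G e}) (edge_torsion G f e) =
      integral {0..len G e} (edge_torsion G f e)"
    by (intro lebesgue_integral_eq_integral continuous_imp_integrable_real) auto
  also have "(edge_torsion G f e has_integral
      (f (source G e) * len G e + b * (len G e)\<^sup>2 / 2 - len G e ^ 3 / 6) -
      (f (source G e) * 0 + b * 0\<^sup>2 / 2 - 0 ^ 3 / 6)) {0..len G e}"
    using assms
    by (intro has_integral_real_derivative[of 0 _ "\<lambda>x. f (source G e) * x + b * x\<^sup>2 / 2 - x ^ 3 / 6"])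
      (auto simp: edge_torsion_def b_def[symmetric] power2_eq_square intro!: derivative_eq_intros)
  then have "integral {0..len G e} (edge_torsion G f e) =
      f (source G e) * len G e + b * (len G e)\<^sup>2 / 2 - len G e ^ 3 / 6"
    by (simp add: has_integral_iff)
  also have "\<dots> = len G e * (f (source G e) + f (target G e)) / 2 + len G e ^ 3 / 12"
    using assms by (simp add: b_def field_simps power2_eq_square power3_eq_cube)
  finally show ?thesis .
qed

lemma normal_derivative_edge_torsion:
  assumes "0 < len G e" and u: "\<And>x. x \<in> {0..len G e} \<Longrightarrow> on_edge G u e x = edge_torsion G f e x"
  shows "normal_derivative G u e 0 =
      (f (source G e) - f (target G e)) / len G e - len G e / 2"
    and "normal_derivative G u e (len G e) =
      (f (target G e) - f (source G e)) / len G e - len G e / 2"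
proof -
  have d: "vector_derivative (on_edge G u e) (at x within {0..len G e}) =
      (f (target G e) - f (source G e)) / len G e + len G e / 2 - x" if x: "x \<in> {0..len G e}" for x
  proof (rule vector_derivative_within_closed_interval[OF assms(1) x])
    have "(edge_torsion G f e has_real_derivative
        (f (target G e) - f (source G e)) / len G e + len G e / 2 - x) (at x within {0..len G e})"
      unfolding edge_torsion_def by (auto intro!: derivative_eq_intros)
    then show "(on_edge G u e has_vector_derivative
        (f (target G e) - f (source G e)) / len G e + len G e / 2 - x) (at x within {0..len G e})"
      unfolding has_real_derivative_iff_has_vector_derivative
      by (rule has_vector_derivative_transform[OF x, rotated]) (simp add: u)
  qed
  show "normal_derivative G u e 0 = (f (source G e) - f (target G e)) / len G e - len G e / 2"
    "normal_derivative G u e (len G e) = (f (target G e) - f (source G e)) / len G e - len G e / 2"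
    using assms(1) by (simp_all add: normal_derivative_def d diff_divide_distrib)
qed

text \<open>The ends at \<open>v\<close> split by coordinate into those at \<open>0\<close> and
  those at \<open>len G e\<close>. The two kinds are disjoint because lengths are positive, so a
  loop is counted twice.\<close>

lemma sum_incident_ends:
  assumes "metric_graph G"
  shows "(\<Sum>(e, x)\<in>incident_ends G v. N e x) =
    (\<Sum>e\<in>edges G. (if source G e = v then N e 0 else 0) + (if target G e = v then N e (len G e) else 0))"
proof -
  have fin: "finite (edges G)" and pos: "\<And>e. e \<in> edges G \<Longrightarrow> 0 < len G e"
    using assms by (auto simp: metric_graph_def)
  define A where "A = (\<lambda>e. (e, 0 :: real)) ` {e \<in> edges G. source G e = v}"
  define B where "B = (\<lambda>e. (e, len G e)) ` {e \<in> edges G. target G e = v}"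
  have "incident_ends G v = A \<union> B"
    by (auto simp: incident_ends_def A_def B_def)
  moreover have "finite A" "finite B"
    using fin by (simp_all add: A_def B_def)
  moreover have "A \<inter> B = {}"
    using pos by (force simp: A_def B_def)
  ultimately have "(\<Sum>(e, x)\<in>incident_ends G v. N e x) = (\<Sum>(e, x)\<in>A. N e x) + (\<Sum>(e, x)\<in>B. N e x)"
    by (simp add: sum.union_disjoint)
  also have "(\<Sum>(e, x)\<in>A. N e x) = (\<Sum>e\<in>edges G. if source G e = v then N e 0 else 0)"
    using fin by (simp add: A_def sum.reindex inj_on_def sum.inter_filter)
  also have "(\<Sum>(e, x)\<in>B. N e x) = (\<Sum>e\<in>edges G. if target G e = v then N e (len G e) else 0)"
    using fin by (simp add: B_def sum.reindex inj_on_def sum.inter_filter)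
  finally show ?thesis
    by (simp add: sum.distrib)
qed

text \<open>A discrete Green identity. Exchanging the sums over vertices and edges collects for each
  edge the normal derivatives at its two ends, weighted by \<open>g\<close>; their difference
  quotients form the energy and their terms \<open>- len G e / 2\<close> the trapezoid sum.\<close>

lemma sum_vertex_conditions:
  assumes G: "metric_graph G"
    and u: "\<And>e x. \<lbrakk>e \<in> edges G; x \<in> {0..len G e}\<rbrakk> \<Longrightarrow> on_edge G u e x = edge_torsion G f e x"
  shows "(\<Sum>v\<in>verts G. g v *
      ((\<Sum>(e, x)\<in>incident_ends G v. normal_derivative G u e x) + \<alpha> v * f v)) =
    dirichlet_form G \<alpha> f g - trapezoid_sum G g"
proof -
  have fin: "finite (verts G)"
    and edge: "\<And>e. e \<in> edges G \<Longrightarrow> source G e \<in> verts G \<and> target G e \<in> verts G \<and> 0 < len G e"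
    using G by (auto simp: metric_graph_def)
  let ?N = "normal_derivative G u"
  have "(\<Sum>v\<in>verts G. g v * (\<Sum>(e, x)\<in>incident_ends G v. ?N e x)) =
      (\<Sum>v\<in>verts G. \<Sum>e\<in>edges G. (if v = source G e then g v * ?N e 0 else 0) +
        (if v = target G e then g v * ?N e (len G e) else 0))"
    by (auto simp: sum_incident_ends[OF G] sum_distrib_left distrib_left intro!: sum.cong)
  also have "\<dots> = (\<Sum>e\<in>edges G. \<Sum>v\<in>verts G. (if v = source G e then g v * ?N e 0 else 0) +
        (if v = target G e then g v * ?N e (len G e) else 0))"
    by (rule sum.swap)
  also have "\<dots> = (\<Sum>e\<in>edges G. g (source G e) * ?N e 0 + g (target G e) * ?N e (len G e))"
    using edge fin by (intro sum.cong refl) (simp add: sum.distrib)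
  also have "\<dots> = (\<Sum>e\<in>edges G.
      (f (source G e) - f (target G e)) * (g (source G e) - g (target G e)) / len G e -
      len G e * (g (source G e) + g (target G e)) / 2)"
  proof (intro sum.cong refl)
    fix e assume e: "e \<in> edges G"
    then have N: "?N e 0 = (f (source G e) - f (target G e)) / len G e - len G e / 2"
      "?N e (len G e) = (f (target G e) - f (source G e)) / len G e - len G e / 2"
      using edge u by (intro normal_derivative_edge_torsion; simp)+
    show "g (source G e) * ?N e 0 + g (target G e) * ?N e (len G e) =
        (f (source G e) - f (target G e)) * (g (source G e) - g (target G e)) / len G e -
        len G e * (g (source G e) + g (target G e)) / 2"
      unfolding N using edge[OF e] by (simp add: field_simps)
  qed
  finally show ?thesis
    by (simp add: dirichlet_form_def trapezoid_sum_def distrib_left sum.distrib sum_subtractf mult_ac)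
qed

lemma vertex_conditions_iff:
  assumes G: "metric_graph G"
    and u: "\<And>e x. \<lbrakk>e \<in> edges G; x \<in> {0..len G e}\<rbrakk> \<Longrightarrow> on_edge G u e x = edge_torsion G f e x"
  shows "(\<forall>v\<in>verts G. (\<Sum>(e, x)\<in>incident_ends G v. normal_derivative G u e x) + \<alpha> v * f v = 0) \<longleftrightarrow>
    discrete_torsion G \<alpha> f"
    (is "(\<forall>v\<in>verts G. ?c v = 0) \<longleftrightarrow> _")
proof
  assume "\<forall>v\<in>verts G. ?c v = 0"
  then have "(\<Sum>v\<in>verts G. g v * ?c v) = 0" for g
    by simp
  then show "discrete_torsion G \<alpha> f"
    using sum_vertex_conditions[OF G u, where \<alpha> = \<alpha>] by (simp add: discrete_torsion_def)
next
  assume D: "discrete_torsion G \<alpha> f"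
  show "\<forall>v\<in>verts G. ?c v = 0"
  proof
    fix v assume "v \<in> verts G"
    moreover have "finite (verts G)"
      using G by (simp add: metric_graph_def)
    \<comment> \<open>Testing with the indicator of \<open>v\<close> isolates the condition at
      \<open>v\<close>.\<close>
    ultimately have "?c v = (\<Sum>w\<in>verts G. (if w = v then 1 else 0) * ?c w)"
      by (simp add: if_distrib[of "\<lambda>x. x * _"] cong: if_cong)
    also have "\<dots> = 0"
      using D sum_vertex_conditions[OF G u, where \<alpha> = \<alpha> and g = "\<lambda>w. if w = v then 1 else 0"]
      by (simp add: discrete_torsion_def)
    finally show "?c v = 0" .
  qed
qed

text \<open>The passage from the operator to finitely many unknowns: du Bois-Reymond fixes
  \<open>u\<close> on each edge by its end values, and the vertex conditions that remain are the
  discrete equation.\<close>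

lemma neg_laplacian_eq_1_iff:
  assumes G: "metric_graph G"
  shows "neg_laplacian_eq G \<alpha> u (\<lambda>_. 1) \<longleftrightarrow>
    discrete_torsion G \<alpha> (\<lambda>v. u (Vertex v)) \<and>
    (\<forall>e\<in>edges G. \<forall>x\<in>{0..len G e}. on_edge G u e x = edge_torsion G (\<lambda>v. u (Vertex v)) e x)"
    (is "?L \<longleftrightarrow> ?D \<and> ?E")
proof -
  have pos: "0 < len G e" if "e \<in> edges G" for e
    using G that by (simp add: metric_graph_def)
  have H2: "H2_second_derivative (len G e) (on_edge G u e) (\<lambda>_. -1)" if ?E "e \<in> edges G" for e
    using that by (intro H2_second_derivative_cong[OF H2_second_derivative_quadratic[OF pos]])
      (auto simp: edge_torsion_def)
  have cont: "continuous_on {0..len G e} (on_edge G u e)" if ?E "e \<in> edges G" for e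
  proof -
    have "continuous_on {0..len G e} (edge_torsion G (\<lambda>v. u (Vertex v)) e)"
      unfolding edge_torsion_def by (intro continuous_intros) auto
    then show ?thesis
      using that by (subst continuous_on_cong[OF refl]) auto
  qed
  have ?E if L: ?L
  proof (intro ballI)
    fix e x assume e: "e \<in> edges G" and x: "x \<in> {0..len G e}"
    obtain h where "H2_second_derivative (len G e) (on_edge G u e) h"
      "AE x in lebesgue_on {0<..<len G e}. - h x = 1"
      using L e by (auto simp: neg_laplacian_eq_def on_edge_def)
    moreover have "continuous_on {0..len G e} (on_edge G u e)"
      using L e by (simp add: neg_laplacian_eq_def laplacian_domain_def
          continuous_map_graph_topology_iff[OF G])
    ultimately obtain c b where cb: "\<And>x. x \<in> {0..len G e} \<Longrightarrow> on_edge G u e x = c + b * x - x\<^sup>2 / 2"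
      using H2_second_derivative_minus_one_imp_quadratic[OF pos[OF e]] by blast
    have "c = u (Vertex (source G e))"
      using cb[of 0] pos[OF e] by (simp add: on_edge_def edge_point_def)
    moreover have "b = (u (Vertex (target G e)) - c) / len G e + len G e / 2"
      using cb[of "len G e"] pos[OF e]
      by (simp add: on_edge_def edge_point_def field_simps power2_eq_square)
    ultimately show "on_edge G u e x = edge_torsion G (\<lambda>v. u (Vertex v)) e x"
      by (simp add: cb[OF x] edge_torsion_def)
  qed
  moreover have "?L \<longleftrightarrow> ?D" if E: ?E
  proof -
    have "?L \<longleftrightarrow> (\<forall>v\<in>verts G.
        (\<Sum>(e, x)\<in>incident_ends G v. normal_derivative G u e x) + \<alpha> v * u (Vertex v) = 0)"
      unfolding neg_laplacian_eq_def laplacian_domain_def continuous_map_graph_topology_iff[OF G]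
      using H2[OF E] cont[OF E] by (auto simp: in_H2_def on_edge_def intro!: exI[of _ "\<lambda>_. -1"])
    also have "\<dots> \<longleftrightarrow> ?D"
      using E by (intro vertex_conditions_iff[OF G]) auto
    finally show ?thesis .
  qed
  ultimately show ?thesis
    by blast
qed

text \<open>
  Gram-Schmidt over the points of \<open>V\<close>: \<open>q\<close> is the indicator of the new point, made orthogonal to
  the functions supported on the previous ones.
\<close>

lemma riesz_representation_finite_support:
  fixes B :: "('a \<Rightarrow> real) \<Rightarrow> ('a \<Rightarrow> real) \<Rightarrow> real"
  assumes "finite V"
    and left: "\<And>f f' c g. B (\<lambda>x. f x + c * f' x) g = B f g + c * B f' g"
    and right: "\<And>f g c g'. B f (\<lambda>x. g x + c * g' x) = B f g + c * B f g'"
    and definite: "\<And>f. \<lbrakk>\<forall>x. x \<notin> V \<longrightarrow> f x = 0; B f f = 0\<rbrakk> \<Longrightarrow> \<forall>x. f x = 0"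
    and linear: "\<And>g g' c. L (\<lambda>x. g x + c * g' x) = L g + c * L g'"
  shows "\<exists>f. (\<forall>x. x \<notin> V \<longrightarrow> f x = 0) \<and> (\<forall>g. (\<forall>x. x \<notin> V \<longrightarrow> g x = 0) \<longrightarrow> B f g = L g)"
  using assms(1) definite linear
proof (induction V arbitrary: L rule: finite_induct)
  case empty
  have "g = (\<lambda>_. 0)" if "\<forall>x. x \<notin> {} \<longrightarrow> g x = 0" for g :: "'a \<Rightarrow> real"
    using that by auto
  moreover have "B f (\<lambda>_. 0) = 0" "L (\<lambda>_. 0) = 0" for f
    using right[of f "\<lambda>_. 0" 1 "\<lambda>_. 0"] empty(2)[of "\<lambda>_. 0" 1 "\<lambda>_. 0"] by simp_all
  ultimately show ?case
    by (metis empty_iff)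
next
  case (insert v V)
  let ?S = "\<lambda>f :: 'a \<Rightarrow> real. \<forall>x. x \<notin> V \<longrightarrow> f x = 0"
  define i where "i = (\<lambda>x. if x = v then 1 else 0 :: real)"
  have definite: "\<forall>x. f x = 0" if "?S f" "B f f = 0" for f
    using insert.prems(1)[of f] that by auto
  obtain p where p: "?S p" "\<And>g. ?S g \<Longrightarrow> B p g = B i g"
    using insert.IH[of "B i", OF definite right] by blast
  obtain f where f: "?S f" "\<And>g. ?S g \<Longrightarrow> B f g = L g"
    using insert.IH[of L, OF definite insert.prems(2)] by blast
  define q where "q = (\<lambda>x. i x + (-1) * p x)"
  have Bq: "B q g = 0" if "?S g" for g
    unfolding q_def left using p(2)[OF that] by simp
  have qv: "q v = 1" and q: "\<And>x. x \<notin> insert v V \<Longrightarrow> q x = 0"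
    using p(1) insert.hyps(2) by (auto simp: q_def i_def)
  have "B q q \<noteq> 0"
    using insert.prems(1)[of q] q qv by force
  \<comment> \<open>\<open>B q\<close> vanishes on functions supported in \<open>V\<close>, so
    adding a multiple of \<open>q\<close> keeps what \<open>f\<close> already represents;
    \<open>c\<close> is then forced by the value of \<open>L\<close> at \<open>q\<close>.\<close>
  define c where "c = (L q - B f q) / B q q"
  have "B (\<lambda>x. f x + c * q x) g = L g" if g: "\<forall>x. x \<notin> insert v V \<longrightarrow> g x = 0" for g
  proof -
    define g' where "g' = (\<lambda>x. g x + (- g v) * q x)"
    have "?S g'"
      using g q qv
      by (metis add.right_neutral add.right_inverse g'_def insert_iff mult.right_neutral mult_zero_right)
    have "g = (\<lambda>x. g' x + g v * q x)"
      by (simp add: g'_def)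
    then have split: "M g = M g' + g v * M q"
      if "\<And>g g' c. M (\<lambda>x. g x + c * g' x) = M g + c * M g'" for M
      using that by metis
    show ?thesis
      unfolding left split[of "B f", OF right] split[of "B q", OF right] split[of L, OF insert.prems(2)]
      using Bq[OF \<open>?S g'\<close>] f(2)[OF \<open>?S g'\<close>] \<open>B q q \<noteq> 0\<close> by (simp add: c_def field_simps)
  qed
  moreover have "\<forall>x. x \<notin> insert v V \<longrightarrow> f x + c * q x = 0"
    using f(1) q by auto
  ultimately show ?case
    by (intro exI[of _ "\<lambda>x. f x + c * q x"]) blast
qed

lemma dirichlet_form_add_scaled:
  "dirichlet_form G \<alpha> (\<lambda>x. f x + c * f' x) g = dirichlet_form G \<alpha> f g + c * dirichlet_form G \<alpha> f' g"
  "dirichlet_form G \<alpha> f (\<lambda>x. g x + c * g' x) = dirichlet_form G \<alpha> f g + c * dirichlet_form G \<alpha> f g'"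
  by (simp_all add: dirichlet_form_def sum_distrib_left sum.distrib[symmetric] distrib_left
      add_divide_distrib diff_divide_distrib algebra_simps)

lemma dirichlet_form_commute: "dirichlet_form G \<alpha> f g = dirichlet_form G \<alpha> g f"
  by (simp add: dirichlet_form_def mult_ac)

lemma trapezoid_sum_add_scaled:
  "trapezoid_sum G (\<lambda>x. f x + c * g x) = trapezoid_sum G f + c * trapezoid_sum G g"
  by (simp add: trapezoid_sum_def sum_distrib_left sum.distrib[symmetric] algebra_simps
      add_divide_distrib)

text \<open>Connectedness appears in its combinatorial form, which passes to the merged graph
  without a construction of paths in its glued space.\<close>

locale torsion_graph =
  fixes G :: "('v, 'e) metric_graph" and \<alpha> :: "'v \<Rightarrow> real"
  assumes metric_graph: "metric_graph G"
    and locally_constant: "\<And>f :: 'v \<Rightarrow> real. \<And>v w.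
      \<lbrakk>\<And>e. e \<in> edges G \<Longrightarrow> f (source G e) = f (target G e); v \<in> verts G; w \<in> verts G\<rbrakk> \<Longrightarrow> f v = f w"
    and strength_nonneg: "\<And>v. v \<in> verts G \<Longrightarrow> 0 \<le> \<alpha> v"
    and strength_nonzero: "\<exists>v\<in>verts G. \<alpha> v \<noteq> 0"
begin

lemma finite_verts: "finite (verts G)"
  and finite_edges: "finite (edges G)"
  and edgeD: "e \<in> edges G \<Longrightarrow> source G e \<in> verts G \<and> target G e \<in> verts G \<and> 0 < len G e"
  using metric_graph by (auto simp: metric_graph_def)

lemma dirichlet_form_nonneg: "0 \<le> dirichlet_form G \<alpha> f f"
  unfolding dirichlet_form_def using edgeD strength_nonneg
  by (intro add_nonneg_nonneg sum_nonneg) (auto simp: mult.assoc less_imp_le)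

text \<open>Both sums are nonnegative, so every term is zero: \<open>f\<close> agrees across each
  edge, hence is constant, and a vertex with nonzero strength forces the constant to be
  \<open>0\<close>.\<close>

lemma dirichlet_form_definite:
  assumes 0: "dirichlet_form G \<alpha> f f = 0" and v: "v \<in> verts G"
  shows "f v = 0"
proof -
  let ?E = "\<lambda>e. (f (source G e) - f (target G e)) * (f (source G e) - f (target G e)) / len G e"
  let ?A = "\<lambda>v. \<alpha> v * f v * f v"
  have nn: "\<And>e. e \<in> edges G \<Longrightarrow> 0 \<le> ?E e" "\<And>v. v \<in> verts G \<Longrightarrow> 0 \<le> ?A v"
    using edgeD strength_nonneg by (auto simp: mult.assoc less_imp_le)
  have "sum ?E (edges G) = 0" "sum ?A (verts G) = 0"
    using 0 sum_nonneg[of "edges G" ?E] sum_nonneg[of "verts G" ?A] nn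
    by (auto simp: dirichlet_form_def)
  then have E: "\<And>e. e \<in> edges G \<Longrightarrow> ?E e = 0" and A: "\<And>v. v \<in> verts G \<Longrightarrow> ?A v = 0"
    using nn by (auto simp: sum_nonneg_eq_0_iff finite_edges finite_verts)
  obtain w where w: "w \<in> verts G" "\<alpha> w \<noteq> 0"
    using strength_nonzero by blast
  have "f (source G e) = f (target G e)" if "e \<in> edges G" for e
    using E[OF that] edgeD[OF that] by simp
  then have "f v = f w"
    using v w(1) by (rule locally_constant)
  then show ?thesis
    using A[OF w(1)] w(2) by simp
qed

lemma discrete_torsion_exists: "\<exists>f. discrete_torsion G \<alpha> f"
proof -
  have "\<forall>x. f x = 0" if "\<forall>x. x \<notin> verts G \<longrightarrow> f x = 0" "dirichlet_form G \<alpha> f f = 0" for f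
    using dirichlet_form_definite[OF that(2)] that(1) by blast
  then obtain f where f: "\<And>g. \<forall>x. x \<notin> verts G \<longrightarrow> g x = 0 \<Longrightarrow> dirichlet_form G \<alpha> f g = trapezoid_sum G g"
    using riesz_representation_finite_support[of "verts G" "dirichlet_form G \<alpha>" "trapezoid_sum G",
        OF finite_verts dirichlet_form_add_scaled _ trapezoid_sum_add_scaled] by blast
  have "dirichlet_form G \<alpha> f g = trapezoid_sum G g" for g
  proof -
    \<comment> \<open>The representation covers test functions supported on the vertices; truncating
      \<open>g\<close> changes neither side, since both only see values at vertices.\<close>
    define g' where "g' = (\<lambda>x. if x \<in> verts G then g x else 0)"
    have "dirichlet_form G \<alpha> f g = dirichlet_form G \<alpha> f g'" "trapezoid_sum G g = trapezoid_sum G g'"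
      using edgeD by (auto simp: dirichlet_form_def trapezoid_sum_def g'_def
          intro!: sum.cong arg_cong2[of _ _ _ _ "(+)"])
    then show ?thesis
      using f[of g'] by (simp add: g'_def)
  qed
  then show ?thesis
    unfolding discrete_torsion_def by blast
qed

lemma discrete_torsion_unique:
  assumes "discrete_torsion G \<alpha> f" "discrete_torsion G \<alpha> f'" "v \<in> verts G"
  shows "f v = f' v"
proof -
  have "dirichlet_form G \<alpha> (\<lambda>x. f x + (-1) * f' x) (\<lambda>x. f x + (-1) * f' x) = 0"
    using assms(1,2) by (simp only: dirichlet_form_add_scaled(1) discrete_torsion_def)
  then show ?thesis
    using dirichlet_form_definite[OF _ assms(3)] by force
qed

lemma torsion_function_on_edge:
  obtains f where "discrete_torsion G \<alpha> f"
    and "\<And>e x. \<lbrakk>e \<in> edges G; x \<in> {0..len G e}\<rbrakk> \<Longrightarrow>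
      on_edge G (torsion_function G \<alpha>) e x = edge_torsion G f e x"
proof -
  obtain f where f: "discrete_torsion G \<alpha> f"
    using discrete_torsion_exists by blast
  \<comment> \<open>Glue the edge solutions with vertex values \<open>f\<close>; the restriction to
    \<open>points G\<close> provides the extensionality demanded by
    \<open>torsion_function\<close>.\<close>
  define u where "u = restrict (\<lambda>p. case p of Vertex v \<Rightarrow> f v | Interior e x \<Rightarrow> edge_torsion G f e x)
    (points G)"
  have uV: "u (Vertex v) = f v" if "v \<in> verts G" for v
    using that by (simp add: u_def points_def)
  have cong: "edge_torsion G (\<lambda>v. w (Vertex v)) e x = edge_torsion G f e x"
    if "\<And>v. v \<in> verts G \<Longrightarrow> w (Vertex v) = f v" "e \<in> edges G" for w :: "('v, 'e) point \<Rightarrow> real" and e x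
    using that edgeD[OF that(2)] by (simp add: edge_torsion_def)
  have on: "on_edge G u e x = edge_torsion G f e x" if "e \<in> edges G" "x \<in> {0..len G e}" for e x
    using that edgeD[OF that(1)] edge_torsion_ends[of G e f] uV
    by (auto simp: on_edge_def edge_point_def u_def points_def)
  have "discrete_torsion G \<alpha> (\<lambda>v. u (Vertex v))"
  proof -
    have "dirichlet_form G \<alpha> (\<lambda>v. u (Vertex v)) g = dirichlet_form G \<alpha> f g" for g
      using edgeD uV by (auto simp: dirichlet_form_def)
    then show ?thesis
      using f by (simp add: discrete_torsion_def)
  qed
  then have "neg_laplacian_eq G \<alpha> u (\<lambda>_. 1)"
    unfolding neg_laplacian_eq_1_iff[OF metric_graph] using on cong[of u] uV by simp
  moreover have "w = u"
    if w: "w \<in> extensional (points G)" "neg_laplacian_eq G \<alpha> w (\<lambda>_. 1)" for w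
  proof
    fix p
    have wV: "w (Vertex v) = f v" if "v \<in> verts G" for v
      using w(2) f that unfolding neg_laplacian_eq_1_iff[OF metric_graph]
      by (auto dest: discrete_torsion_unique)
    show "w p = u p"
    proof (cases "p \<in> points G")
      case True
      then consider v where "v \<in> verts G" "p = Vertex v"
        | e x where "e \<in> edges G" "0 < x" "x < len G e" "p = Interior e x"
        by (auto simp: points_def)
      then show ?thesis
      proof cases
        case 1
        then show ?thesis by (simp add: wV uV)
      next
        case 2
        have "on_edge G w e x = edge_torsion G (\<lambda>v. w (Vertex v)) e x"
          using w(2) 2 unfolding neg_laplacian_eq_1_iff[OF metric_graph] by auto
        also have "\<dots> = on_edge G u e x"
          using 2 on[of e x] cong[of w e x] wV by simp
        finally show ?thesis
          using 2 by (simp add: on_edge_def edge_point_def)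
      qed
    next
      case False
      then show ?thesis
        using w(1) by (simp add: u_def extensional_def)
    qed
  qed
  ultimately have "torsion_function G \<alpha> = u"
    unfolding torsion_function_def by (intro the_equality) (auto simp: u_def)
  then show ?thesis
    using that[OF f] on by simp
qed

lemma torsional_rigidity_eq:
  obtains f where "discrete_torsion G \<alpha> f"
    and "torsional_rigidity G \<alpha> = trapezoid_sum G f + (\<Sum>e\<in>edges G. len G e ^ 3 / 12)"
proof -
  obtain f where f: "discrete_torsion G \<alpha> f"
    and on: "\<And>e x. \<lbrakk>e \<in> edges G; x \<in> {0..len G e}\<rbrakk> \<Longrightarrow>
      on_edge G (torsion_function G \<alpha>) e x = edge_torsion G f e x"
    using torsion_function_on_edge by blast
  have "integral\<^sup>L (lebesgue_on {0..len G e}) (on_edge G (torsion_function G \<alpha>) e) =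
      len G e * (f (source G e) + f (target G e)) / 2 + len G e ^ 3 / 12" if e: "e \<in> edges G" for e
  proof -
    have "integral\<^sup>L (lebesgue_on {0..len G e}) (on_edge G (torsion_function G \<alpha>) e) =
        integral\<^sup>L (lebesgue_on {0..len G e}) (edge_torsion G f e)"
      using on[OF e] by (intro Bochner_Integration.integral_cong) auto
    then show ?thesis
      using integral_edge_torsion[of G e f] edgeD[OF e] by simp
  qed
  then have "torsional_rigidity G \<alpha> = trapezoid_sum G f + (\<Sum>e\<in>edges G. len G e ^ 3 / 12)"
    by (simp add: torsional_rigidity_def graph_integral_def trapezoid_sum_def sum.distrib)
  with f show ?thesis
    by (rule that)
qed

end

text \<open>
  Minus the energy \<open>\<integral> u'\<^sup>2 - 2 u\<close> (plus boundary terms) of the function \<open>u\<close> which takes the values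
  \<open>f\<close> at the vertices and solves \<open>- u'' = 1\<close> on the edges.
\<close>

definition torsion_functional :: "('v, 'e) metric_graph \<Rightarrow> ('v \<Rightarrow> real) \<Rightarrow> ('v \<Rightarrow> real) \<Rightarrow> real" where
  "torsion_functional G \<alpha> f =
     2 * trapezoid_sum G f - dirichlet_form G \<alpha> f f + (\<Sum>e\<in>edges G. len G e ^ 3 / 12)"

context torsion_graph
begin

text \<open>Completing the square: by the discrete equation for \<open>f\<close>, the difference of
  the two sides is the energy of \<open>f - g\<close>.\<close>

lemma torsion_functional_le: "torsion_functional G \<alpha> g \<le> torsional_rigidity G \<alpha>"
proof -
  obtain f where f: "discrete_torsion G \<alpha> f"
    and T: "torsional_rigidity G \<alpha> = trapezoid_sum G f + (\<Sum>e\<in>edges G. len G e ^ 3 / 12)"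
    by (rule torsional_rigidity_eq)
  have "0 \<le> dirichlet_form G \<alpha> (\<lambda>x. f x + (-1) * g x) (\<lambda>x. f x + (-1) * g x)"
    by (rule dirichlet_form_nonneg)
  also have "\<dots> = dirichlet_form G \<alpha> f f - 2 * dirichlet_form G \<alpha> f g + dirichlet_form G \<alpha> g g"
    by (simp only: dirichlet_form_add_scaled dirichlet_form_commute[of G \<alpha> g f]) simp
  finally show ?thesis
    using f by (simp add: torsion_functional_def T discrete_torsion_def)
qed

lemma torsion_functional_attained: "\<exists>f. torsion_functional G \<alpha> f = torsional_rigidity G \<alpha>"
proof -
  obtain f where "discrete_torsion G \<alpha> f"
    and "torsional_rigidity G \<alpha> = trapezoid_sum G f + (\<Sum>e\<in>edges G. len G e ^ 3 / 12)"
    by (rule torsional_rigidity_eq)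
  then have "torsion_functional G \<alpha> f = torsional_rigidity G \<alpha>"
    by (simp add: torsion_functional_def discrete_torsion_def)
  then show ?thesis
    by blast
qed

end

section \<open>Merging pendant edges\<close>

definition edge_functional :: "real \<Rightarrow> real \<Rightarrow> real \<Rightarrow> real" where
  "edge_functional l a b = l * (a + b) - (a - b)\<^sup>2 / l + l ^ 3 / 12"

lemma torsion_functional_eq_sum:
  "torsion_functional G \<alpha> f =
     (\<Sum>e\<in>edges G. edge_functional (len G e) (f (source G e)) (f (target G e))) -
     (\<Sum>v\<in>verts G. \<alpha> v * (f v)\<^sup>2)"
  by (simp add: torsion_functional_def trapezoid_sum_def dirichlet_form_def edge_functional_def
      sum.distrib sum_subtractf sum_distrib_left power2_eq_square mult.assoc)

lemma edge_functional_commute: "edge_functional l a b = edge_functional l b a"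
  by (simp add: edge_functional_def power2_commute add.commute)

text \<open>Without a strength, the optimal value at the free end of a pendant edge is \<open>a + l\<^sup>2 / 2\<close>.\<close>

lemma edge_functional_free_end:
  assumes "0 < l"
  shows "edge_functional l a b \<le> 2 * l * a + l ^ 3 / 3"
    and "edge_functional l a (a + l\<^sup>2 / 2) = 2 * l * a + l ^ 3 / 3"
proof -
  \<comment> \<open>Complete the square in \<open>b\<close>; its constant \<open>l ^ 3 / 4\<close>
    joins \<open>l ^ 3 / 12\<close> to give \<open>l ^ 3 / 3\<close>.\<close>
  have *: "edge_functional l a b = 2 * l * a + l ^ 3 / 3 - (b - a - l\<^sup>2 / 2)\<^sup>2 / l" for b
    using assms by (simp add: edge_functional_def field_simps power2_eq_square power3_eq_cube)
  show "edge_functional l a b \<le> 2 * l * a + l ^ 3 / 3"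
    using assms by (simp add: *)
  show "edge_functional l a (a + l\<^sup>2 / 2) = 2 * l * a + l ^ 3 / 3"
    by (simp add: *)
qed

text \<open>Each summand is at most the total, so two of the three factors of each cube can be
  replaced by the total.\<close>

lemma sum_power3_le_power3_sum:
  fixes f :: "'a \<Rightarrow> real"
  assumes "finite A" "\<And>x. x \<in> A \<Longrightarrow> 0 \<le> f x"
  shows "(\<Sum>x\<in>A. f x ^ 3) \<le> (\<Sum>x\<in>A. f x) ^ 3"
proof -
  have "f x ^ 3 \<le> f x * (\<Sum>x\<in>A. f x)\<^sup>2" if "x \<in> A" for x
    using assms that
    by (auto simp: power3_eq_cube power2_eq_square mult.assoc
        intro!: mult_left_mono mult_mono member_le_sum sum_nonneg)
  then have "(\<Sum>x\<in>A. f x ^ 3) \<le> (\<Sum>x\<in>A. f x * (\<Sum>x\<in>A. f x)\<^sup>2)"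
    by (rule sum_mono)
  then show ?thesis
    by (simp add: sum_distrib_right[symmetric] power3_eq_cube power2_eq_square)
qed

text \<open>Every edge at \<open>w\<close> contributes an end to the singleton
  \<open>incident_ends G w\<close>, and a loop would contribute two.\<close>

lemma degree_one_unique_edge:
  assumes "metric_graph G" "vertex_degree G w = 1" "e \<in> edges G" "w \<in> endpoints G e"
  shows "\<And>e'. e' \<in> edges G \<Longrightarrow> w \<in> endpoints G e' \<Longrightarrow> e' = e" and "source G e \<noteq> target G e"
proof -
  obtain z where z: "incident_ends G w = {z}"
    using assms(2) by (auto simp: vertex_degree_def card_1_singleton_iff)
  have "\<exists>x. (d, x) \<in> incident_ends G w" if "d \<in> edges G" "w \<in> endpoints G d" for d
    using that by (auto simp: incident_ends_def endpoints_def)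
  then have fst: "d = fst z" if "d \<in> edges G" "w \<in> endpoints G d" for d
    using that z by fastforce
  show "e' = e" if "e' \<in> edges G" "w \<in> endpoints G e'" for e'
    using fst[OF that] fst[OF assms(3,4)] by simp
  show "source G e \<noteq> target G e"
  proof
    assume "source G e = target G e"
    then have "(e, 0) \<in> incident_ends G w" "(e, len G e) \<in> incident_ends G w"
      using assms(3,4) by (auto simp: incident_ends_def endpoints_def)
    then have "len G e = 0"
      by (auto simp: z)
    then show False
      using assms(1,3) by (auto simp: metric_graph_def)
  qed
qed

theorem theorem7p9:
  fixes G Gt :: "('v, 'e) metric_graph"
    and \<alpha> \<alpha>t :: "'v \<Rightarrow> real"
    and r :: nat
    and e :: "nat \<Rightarrow> 'e" and v :: "nat \<Rightarrow> 'v"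
    and v0 v_hat :: 'v and e_hat :: 'e
  assumes "metric_graph G" and "connected_graph G"
    and "\<forall>w\<in>verts G. 0 \<le> \<alpha> w" and "\<exists>w\<in>verts G. \<alpha> w \<noteq> 0"
    and "1 \<le> r" and "inj_on e {1..r}"
    and "\<forall>j\<in>{1..r}. pendant G (e j) \<and> endpoints G (e j) = {v0, v j} \<and> vertex_degree G (v j) = 1"
    and "e_hat \<notin> edges G" and "v_hat \<notin> verts G"
    and "Gt = merge_pendant_edges G r e v v0 e_hat v_hat"
    and "\<forall>w\<in>verts G - v ` {1..r}. \<alpha>t w = \<alpha> w" and "\<alpha>t v_hat = 0"
    and "\<exists>w\<in>verts Gt. \<alpha>t w \<noteq> 0"
  shows "torsional_rigidity G \<alpha> \<le> torsional_rigidity Gt \<alpha>t"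
proof -

  \<comment> \<open>Combinatorics of the merged graph\<close>
  have fin: "finite (verts G)" "finite (edges G)"
    and edgeD: "\<And>d. d \<in> edges G \<Longrightarrow> source G d \<in> verts G \<and> target G d \<in> verts G \<and> 0 < len G d"
    using assms(1) by (auto simp: metric_graph_def)
  let ?P = "e ` {1..r}" and ?W = "v ` {1..r}"
  define L where "L = (\<Sum>j=1..r. len G (e j))"
  have e: "e j \<in> edges G" and ends: "endpoints G (e j) = {v0, v j}"
    and deg: "vertex_degree G (v j) = 1" if "j \<in> {1..r}" for j
    using assms(7) that by (auto simp: pendant_def)
  have "L > 0"
    unfolding L_def using e edgeD assms(5) by (intro sum_pos) auto
  have "{v0, v j} \<subseteq> verts G" if "j \<in> {1..r}" for j
    unfolding ends[OF that, symmetric] using edgeD[OF e[OF that]] by (simp add: endpoints_def)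
  with assms(5) have v0: "v0 \<in> verts G" and v: "?W \<subseteq> verts G"
    by auto
  have uniq: "d = e j" if "j \<in> {1..r}" "d \<in> edges G" "v j \<in> endpoints G d" for d j
    using degree_one_unique_edge(1)[OF assms(1) deg e _ that(2)] that ends by auto
  \<comment> \<open>Otherwise some \<open>e j\<close> would be a loop at a vertex of degree one.
    Hence \<open>v0\<close> survives the removal.\<close>
  have "v0 \<notin> ?W"
  proof
    assume "v0 \<in> ?W"
    then obtain j where j: "j \<in> {1..r}" "v0 = v j"
      by blast
    show False
      using degree_one_unique_edge(2)[OF assms(1) deg[OF j(1)] e[OF j(1)]] ends[OF j(1)] j(2)
      by (auto simp: endpoints_def)
  qed
  have rest: "source G d \<notin> ?W" "target G d \<notin> ?W" if "d \<in> edges G - ?P" for d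
  proof -
    have "w \<notin> ?W" if "w \<in> endpoints G d" for w
      using uniq[of _ d] that \<open>d \<in> edges G - ?P\<close> by blast
    then show "source G d \<notin> ?W" "target G d \<notin> ?W"
      by (simp_all add: endpoints_def)
  qed
  have "e_hat \<notin> edges G - ?P" "v_hat \<notin> verts G - ?W"
    using assms(8,9) by auto
  have Gt: "verts Gt = insert v_hat (verts G - ?W)" "edges Gt = insert e_hat (edges G - ?P)"
    "source Gt e_hat = v0" "target Gt e_hat = v_hat" "len Gt e_hat = L"
    "\<And>d. d \<in> edges G - ?P \<Longrightarrow> source Gt d = source G d"
    "\<And>d. d \<in> edges G - ?P \<Longrightarrow> target Gt d = target G d"
    "\<And>d. d \<in> edges G - ?P \<Longrightarrow> len Gt d = len G d"
  proof -
    have "v_hat \<notin> ?W"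
      using v assms(9) by blast
    then show "verts Gt = insert v_hat (verts G - ?W)"
      by (auto simp: assms(10) merge_pendant_edges_def)
  qed (use assms(8) in \<open>auto simp: assms(10) merge_pendant_edges_def L_def\<close>)

  \<comment> \<open>Both graphs have a discrete torsion problem\<close>
  interpret G: torsion_graph G \<alpha>
    using assms(1-4) connected_graph_locally_constant[OF assms(1,2)] by unfold_locales auto
  interpret Gt: torsion_graph Gt \<alpha>t
  proof
    show "metric_graph Gt"
      unfolding metric_graph_def using fin edgeD rest Gt \<open>v0 \<in> verts G\<close> \<open>v0 \<notin> ?W\<close> \<open>L > 0\<close> by simp
    show "f x = f y" if f: "\<And>d. d \<in> edges Gt \<Longrightarrow> f (source Gt d) = f (target Gt d)"
      and xy: "x \<in> verts Gt" "y \<in> verts Gt" for f :: "'v \<Rightarrow> real" and x y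
    proof -
      \<comment> \<open>Give the removed vertices the value at \<open>v0\<close>; then
        \<open>f'\<close> agrees across every edge of \<open>G\<close>, including the removed ones,
        and connectedness of \<open>G\<close> applies.\<close>
      define f' where "f' = (\<lambda>w. if w \<in> ?W then f v0 else f w)"
      have f': "f' (source G d) = f' (target G d)" if d: "d \<in> edges G" for d
      proof (cases "d \<in> ?P")
        case True
        then obtain j where "j \<in> {1..r}" "endpoints G d = {v0, v j}"
          using ends by blast
        then have "f' (source G d) = f v0" "f' (target G d) = f v0"
          by (auto simp: endpoints_def doubleton_eq_iff f'_def)
        then show ?thesis by simp
      next
        case False
        then show ?thesis
          using d f[of d] rest[of d] Gt by (simp add: f'_def)
      qed
      have "f w = f v0" if "w \<in> verts Gt" for w
      proof (cases "w = v_hat")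
        case True
        then show ?thesis using f[of e_hat] Gt by simp
      next
        case False
        then have w: "w \<in> verts G" "w \<notin> ?W"
          using that Gt by auto
        then have "f' w = f' v0"
          using G.locally_constant[of f', OF f'] v0 by blast
        then show ?thesis
          using w \<open>v0 \<notin> ?W\<close> by (simp add: f'_def)
      qed
      then show ?thesis
        using xy by metis
    qed
    show "0 \<le> \<alpha>t w" if "w \<in> verts Gt" for w
      using that assms(3,11,12) Gt by auto
    show "\<exists>w\<in>verts Gt. \<alpha>t w \<noteq> 0"
      by (rule assms(13))
  qed

  \<comment> \<open>Comparison of the functionals\<close>
  obtain f where f: "torsion_functional G \<alpha> f = torsional_rigidity G \<alpha>"
    using G.torsion_functional_attained by blast
  \<comment> \<open>A maximiser for \<open>G\<close> is carried over as a competitor for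
    \<open>Gt\<close>, with the optimal free-end value at \<open>v_hat\<close>.\<close>
  define g where "g = f(v_hat := f v0 + L\<^sup>2 / 2)"
  have g: "g w = f w" if "w \<in> verts G" for w
    using that assms(9) by (auto simp: g_def)
  let ?F = "\<lambda>d. edge_functional (len G d) (f (source G d)) (f (target G d))"
  let ?Ft = "\<lambda>d. edge_functional (len Gt d) (g (source Gt d)) (g (target Gt d))"

  have "sum ?F ?P = (\<Sum>j=1..r. ?F (e j))"
    using assms(6) by (simp add: sum.reindex)
  also have "\<dots> \<le> (\<Sum>j=1..r. 2 * len G (e j) * f v0 + len G (e j) ^ 3 / 3)"
  proof (rule sum_mono)
    fix j assume j: "j \<in> {1..r}"
    \<comment> \<open>The orientation of \<open>e j\<close> is arbitrary, so symmetry of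
      \<open>edge_functional\<close> is used to put \<open>v0\<close> first.\<close>
    have "?F (e j) = edge_functional (len G (e j)) (f v0) (f (v j))"
      using ends[OF j] edge_functional_commute by (auto simp: endpoints_def doubleton_eq_iff)
    then show "?F (e j) \<le> 2 * len G (e j) * f v0 + len G (e j) ^ 3 / 3"
      using edgeD[OF e[OF j]] by (simp add: edge_functional_free_end(1))
  qed
  also have "\<dots> = 2 * L * f v0 + (\<Sum>j=1..r. len G (e j) ^ 3) / 3"
    by (simp add: L_def sum.distrib sum_distrib_left sum_distrib_right sum_divide_distrib)
  also have "\<dots> \<le> 2 * L * f v0 + L ^ 3 / 3"
    using sum_power3_le_power3_sum[of "{1..r}" "\<lambda>j. len G (e j)"] edgeD[OF e]
    by (simp add: L_def less_imp_le)
  also have "\<dots> = ?Ft e_hat"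
    using Gt g[OF v0] \<open>L > 0\<close> by (simp add: edge_functional_free_end(2)[symmetric] g_def)
  finally have pend: "sum ?F ?P \<le> ?Ft e_hat" .

  have "sum ?F (edges G) = sum ?F (edges G - ?P) + sum ?F ?P"
    using fin e by (intro sum.subset_diff) auto
  also have "sum ?F (edges G - ?P) = sum ?Ft (edges G - ?P)"
    using edgeD g Gt(6-8) by (intro sum.cong refl) simp
  also have "\<dots> + sum ?F ?P \<le> sum ?Ft (edges Gt)"
    using fin pend \<open>e_hat \<notin> edges G - ?P\<close> by (simp add: Gt(2))
  finally have edges: "sum ?F (edges G) \<le> sum ?Ft (edges Gt)" .

  \<comment> \<open>The vertex \<open>v_hat\<close> adds nothing since its strength is
    \<open>0\<close>, and the penalties dropped at the removed vertices were nonnegative.\<close>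
  have "(\<Sum>w\<in>verts Gt. \<alpha>t w * (g w)\<^sup>2) = (\<Sum>w\<in>verts G - ?W. \<alpha> w * (f w)\<^sup>2)"
    using fin \<open>v_hat \<notin> verts G - ?W\<close> assms(11,12) g by (simp add: Gt(1))
  also have "\<dots> \<le> (\<Sum>w\<in>verts G. \<alpha> w * (f w)\<^sup>2)"
    using fin assms(3) by (intro sum_mono2) auto
  finally have "torsion_functional G \<alpha> f \<le> torsion_functional Gt \<alpha>t g"
    using edges by (simp add: torsion_functional_eq_sum)
  also have "\<dots> \<le> torsional_rigidity Gt \<alpha>t"
    by (rule Gt.torsion_functional_le)
  finally show ?thesis
    by (simp add: f)
qed

end
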